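(* Consider the analyst's optimization problem for moment estimation with the Horvitz-Thompson estimator: given a cost distribution $\mathcal F$ with finite support $\mathcal C=\{c_1<\dots<c_{|\mathcal C|}\}\subset(0,\infty)$, $\pi_t=\Pr[c=c_t]>0$, and $\bar B=B/n$ with $0<\bar B<\mathbb E[c]$, minimize the worst-case variance $\mathbb V^*(\hat\theta_S;\mathcal F,A)$ over monotone non-increasing $A=(A_1,\dots,A_{|\mathcal C|})\in(0,1]^{|\mathcal C|}$ subject to $\sum_t\pi_tc_tA_t\le\bar B$. The optimal allocation rule $A$ is determined by two constants $\bar A$ and $t^*\in\{0,\dots,|\mathcal C|\}$ such that $$A_t=\begin{cases}\bar A&\text{if }t\le t^*,\\ \dfrac1{\sqrt{c_t}}\cdot\dfrac{\bar B-\bar A\,\mathbb E[c\cdot1\{c\le c_{t^*}\}]}{\mathbb E[\sqrt c\cdot1\{c>c_{t^*}\}]}&\text{otherwise.}\end{cases}$$ The parameters are determined as follows. With $c_0=0$ and $c_{|\mathcal C|+1}=\infty$, for $k\in\{0,1,\dots,|\mathcal C|+1\}$ and $x\in(0,1]$ let $$Q(k,x)=\sum_{t=1}^k\pi_tc_t+\sum_{t=k+1}^{|\mathcal C|}\pi_t\sqrt{\frac{c_tc_k}{x}},\qquad R(k,x)=2\Big(\sum_{t=1}^k\pi_t\frac{c_t\,x}{c_k}+\sum_{t=k+1}^{|\mathcal C|}\pi_t\Big),\qquad B(k,x)=\frac{Q(k,x)}{R(k,x)}.$$ Let $k^*$ be the unique $k$ such that $B(k,1)\le\bar B<B(k+1,1)$.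 If $k^*=0$ then $t^*=0$. Otherwise let $x^*\in(0,1]$ be the unique solution of $\bar B=B(k^*,x^* )$. If $R(k^*,x^* )\ge1$, then $t^*=k^*$ and $\bar A=\frac1{R(k^*,x^* )}$. If $R(k^*,x^* )<1$, then $t^*=\max\{k:\bar B>Q(k,1)\}$ and $\bar A=1$.
   Context: Setting. There are $n$ agents; agent $i$ has a pair $(z_i,c_i)$ with data $z_i\in\mathcal Z$ and cost $c_i>0$, drawn i.i.d. from a distribution $\mathcal D$ on $\mathcal Z\times\mathcal C$. The marginal of costs is $\mathcal F$ (known); $\mathcal D$ is called consistent with $\mathcal F$ if its cost marginal is $\mathcal F$. An allocation rule is a function $A:\mathcal C\to(0,1]$, $A_t=A(c_t)$; given the costs, each agent $i$ is put in the sample $S$ with probability $A(c_i)$, independently of everything else. There is a (measurable) moment function $m:\mathcal Z\to[0,1]$ which attains both values $0$ and $1$, the parameter of interest is $\theta=\mathbb E[m(z)]$, and the Horvitz-Thompson estimator is $$\hat\theta_S=\frac1n\sum_{i=1}^n\frac{m(z_i)\,1\{i\in S\}}{A(c_i)}.$$ $\mathbb V(\hat\theta_S;\mathcal D,A)$ denotes its variance, and $\mathbb V^*(\hat\theta_S;\mathcal F,A)=\sup\mathbb V(\hat\theta_S;\mathcal D,A)$, the supremum being over all $\mathcal D$ consistent with $\mathcal F$. Expectations $\mathbb E[g(c)]$ are over $c\sim\mathcal F$. Conventions for the extreme indices: $B(0,1)=0$ (since $c_0=0$, with $Q(0,1)=0$, $R(0,1)=2$) and $B(|\mathcal C|+1,1)=+\infty$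 (since $c_{|\mathcal C|+1}=\infty$); thus $k^*\in\{0,\dots,|\mathcal C|\}$, and the maximum defining $t^*$ is over $k\in\{0,\dots,|\mathcal C|\}$. When $t^*=0$ the first case of the formula for $A_t$ is empty (and $\bar A\,\mathbb E[c\cdot 1\{c\le c_0\}]=0$); when $t^*=|\mathcal C|$ the second case is empty. *)

theory Defs
  imports "HOL-Probability.Probability"
begin


text \<open>An agent is a pair \<open>(z, c)\<close> of data and cost. The cost marginal is a finitely supported
  \<open>pmf\<close> on the reals, and the cost space is its support with the discrete sigma-algebra.\<close>

definition consistent :: "'z measure \<Rightarrow> real pmf \<Rightarrow> ('z \<times> real) measure \<Rightarrow> bool" where
  "consistent Z F D \<longleftrightarrow>
     prob_space D \<and> sets D = sets (Z \<Otimes>\<^sub>M count_space (set_pmf F)) \<and>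
     distr D (count_space UNIV) snd = measure_pmf F"

text \<open>Joint law of \<open>((z, c), b)\<close>, where the Boolean \<open>b\<close> says whether the agent is sampled; given
  \<open>(z, c)\<close> this happens with probability \<open>A c\<close>.\<close>

definition agent_law :: "('z \<times> real) measure \<Rightarrow> (real \<Rightarrow> real) \<Rightarrow> (('z \<times> real) \<times> bool) measure" where
  "agent_law D A =
     D \<bind> (\<lambda>zc. distr (measure_pmf (bernoulli_pmf (A (snd zc))))
                    (D \<Otimes>\<^sub>M count_space UNIV) (\<lambda>b. (zc, b)))"

definition population_law ::
    "nat \<Rightarrow> ('z \<times> real) measure \<Rightarrow> (real \<Rightarrow> real) \<Rightarrow> (nat \<Rightarrow> ('z \<times> real) \<times> bool) measure" where
  "population_law n D A = (\<Pi>\<^sub>M i\<in>{1..n}. agent_law D A)"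

definition sample_set :: "nat \<Rightarrow> (nat \<Rightarrow> ('z \<times> real) \<times> bool) \<Rightarrow> nat set" where
  "sample_set n \<omega> = {i \<in> {1..n}. snd (\<omega> i)}"

definition HT_estimator ::
    "('z \<Rightarrow> real) \<Rightarrow> nat \<Rightarrow> (real \<Rightarrow> real) \<Rightarrow> (nat \<Rightarrow> ('z \<times> real) \<times> bool) \<Rightarrow> real" where
  "HT_estimator m n A \<omega> =
     (1 / real n) * (\<Sum>i=1..n. m (fst (fst (\<omega> i))) * indicator (sample_set n \<omega>) i
                                / A (snd (fst (\<omega> i))))"

definition HT_variance ::
    "('z \<Rightarrow> real) \<Rightarrow> nat \<Rightarrow> ('z \<times> real) measure \<Rightarrow> (real \<Rightarrow> real) \<Rightarrow> real" where
  "HT_variance m n D A = prob_space.variance (population_law n D A) (HT_estimator m n A)"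

definition worst_variance ::
    "'z measure \<Rightarrow> ('z \<Rightarrow> real) \<Rightarrow> nat \<Rightarrow> real pmf \<Rightarrow> (real \<Rightarrow> real) \<Rightarrow> ereal" where
  "worst_variance Z m n F A = (SUP D\<in>{D. consistent Z F D}. ereal (HT_variance m n D A))"



definition num_costs :: "real pmf \<Rightarrow> nat" where
  "num_costs F = card (set_pmf F)"

text \<open>The support in increasing order, indexed from 1, with the convention \<open>c\<^sub>0 = 0\<close>.\<close>

definition cost :: "real pmf \<Rightarrow> nat \<Rightarrow> real" where
  "cost F t = (if t = 0 then 0 else sorted_list_of_set (set_pmf F) ! (t - 1))"

definition prob_cost :: "real pmf \<Rightarrow> nat \<Rightarrow> real" where
  "prob_cost F t = pmf F (cost F t)"

definition feasible :: "real pmf \<Rightarrow> real \<Rightarrow> (real \<Rightarrow> real) \<Rightarrow> bool" where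
  "feasible F Bbar A \<longleftrightarrow>
     (\<forall>c\<in>set_pmf F. 0 < A c \<and> A c \<le> 1) \<and>
     antimono_on (set_pmf F) A \<and>
     (\<Sum>t=1..num_costs F. prob_cost F t * cost F t * A (cost F t)) \<le> Bbar"

definition optimal ::
    "'z measure \<Rightarrow> ('z \<Rightarrow> real) \<Rightarrow> nat \<Rightarrow> real pmf \<Rightarrow> real \<Rightarrow> (real \<Rightarrow> real) \<Rightarrow> bool" where
  "optimal Z m n F Bbar A \<longleftrightarrow>
     feasible F Bbar A \<and>
     (\<forall>A'. feasible F Bbar A' \<longrightarrow> worst_variance Z m n F A \<le> worst_variance Z m n F A')"



definition Q :: "real pmf \<Rightarrow> nat \<Rightarrow> real \<Rightarrow> real" where
  "Q F k x =
     (\<Sum>t=1..k. prob_cost F t * cost F t) +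
     (\<Sum>t=k+1..num_costs F. prob_cost F t * sqrt (cost F t * cost F k / x))"

definition R :: "real pmf \<Rightarrow> nat \<Rightarrow> real \<Rightarrow> real" where
  "R F k x =
     2 * ((\<Sum>t=1..k. prob_cost F t * (cost F t * x / cost F k)) +
          (\<Sum>t=k+1..num_costs F. prob_cost F t))"

text \<open>The infinite value beyond the last index is the convention \<open>c\<^sub>k = \<infinity>\<close> for
  \<open>k = num_costs F + 1\<close>; \<open>Q\<close> and \<open>R\<close> are only used for \<open>k \<le> num_costs F\<close>.\<close>

definition budget_fn :: "real pmf \<Rightarrow> nat \<Rightarrow> real \<Rightarrow> ereal" where
  "budget_fn F k x = (if k \<le> num_costs F then ereal (Q F k x / R F k x) else \<infinity>)"

definition is_kstar :: "real pmf \<Rightarrow> real \<Rightarrow> nat \<Rightarrow> bool" where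
  "is_kstar F Bbar k \<longleftrightarrow>
     k \<le> num_costs F \<and> budget_fn F k 1 \<le> ereal Bbar \<and> ereal Bbar < budget_fn F (k + 1) 1"

definition is_xstar :: "real pmf \<Rightarrow> real \<Rightarrow> nat \<Rightarrow> real \<Rightarrow> bool" where
  "is_xstar F Bbar k x \<longleftrightarrow> 0 < x \<and> x \<le> 1 \<and> ereal Bbar = budget_fn F k x"

text \<open>\<open>is_params F Bbar t a\<close>: the threshold is \<open>t\<close> and the initial value of the rule is \<open>a\<close>.
  In the case \<open>k = 0\<close> the value \<open>a\<close> is irrelevant (it does not influence the rule) and is left
  unconstrained.\<close>

definition is_params :: "real pmf \<Rightarrow> real \<Rightarrow> nat \<Rightarrow> real \<Rightarrow> bool" where
  "is_params F Bbar t a \<longleftrightarrow>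
     (\<exists>k. is_kstar F Bbar k \<and>
        (if k = 0 then t = 0
         else (\<exists>x. is_xstar F Bbar k x \<and>
                (if R F k x \<ge> 1 then t = k \<and> a = 1 / R F k x
                 else t = Max {j \<in> {0..num_costs F}. Bbar > Q F j 1} \<and> a = 1))))"

definition threshold_rule :: "real pmf \<Rightarrow> real \<Rightarrow> nat \<Rightarrow> real \<Rightarrow> nat \<Rightarrow> real" where
  "threshold_rule F Bbar tstar a t =
     (if t \<le> tstar then a
      else 1 / sqrt (cost F t) *
        ((Bbar - a * measure_pmf.expectation F (\<lambda>c. c * indicator {..cost F tstar} c)) /
         measure_pmf.expectation F (\<lambda>c. sqrt c * indicator {cost F tstar<..} c)))"

end

(* Only binary data matter for the worst case, and then n times the variance is
   sum_c pi_c q_c / A_c - (sum_c pi_c q_c)^2, where q_c is the mean of m given cost c. This is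
   concave in q and convex in A, so the optimal rule is found from a saddle point (A, q). Convexity in
   A is strict because q_c > 0 for all c, hence the optimal rule is unique.

   With v = c_k / x, the functions Q(k, x) and R(k, x) become functions of the level v alone:
   Q(v) = sum_c pi_c c min(1, sqrt(v/c)) and R(v) = 2 sum_c pi_c min(1, c/v). Their quotient
   increases continuously from 0 to infinity, so the budget determines a level y = c_k / x with
   k = k*, x = x*. If R(y) >= 1, the saddle point is
   A_c = min(1, sqrt(y/c)) / R(y), q_c = min(1, c/y). Otherwise the constraint A <= 1 binds:
   A_c = min(1, sqrt(w/c)) with Q(w) equal to the budget, and q_c >= min(1, c/w) is chosen such that
   sum_c pi_c q_c = 1/2. *)
theory Submission
  imports Defs
begin

section \<open>Variance of the Horvitz-Thompson estimator\<close>

text \<open>With \<open>Y\<close> the centred summand, the squared deviation is a double sum of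
  products \<open>Y (\<omega> i) * Y (\<omega> j)\<close>. Off-diagonal terms integrate to zero by
  independence, and \<open>n\<close> equal diagonal terms remain against the factor 1/n^2.\<close>

lemma variance_mean_PiM:
  fixes X :: "'a \<Rightarrow> real"
  assumes M: "prob_space M" and n: "n \<ge> 1"
    and X: "integrable M X" and X2: "integrable M (\<lambda>x. (X x)\<^sup>2)"
  shows "prob_space.variance (\<Pi>\<^sub>M i\<in>{1..n}. M) (\<lambda>\<omega>. (1 / real n) * (\<Sum>i=1..n. X (\<omega> i))) =
           (1 / real n) * prob_space.variance M X"
proof -
  interpret M: prob_space M by fact
  interpret P: product_prob_space "\<lambda>_. M" "{1..n}"
    by (intro product_prob_spaceI M)
  let ?P = "\<Pi>\<^sub>M i\<in>{1..n}. M"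
  define \<mu> where "\<mu> = M.expectation X"
  define Y where "Y = (\<lambda>x. X x - \<mu>)"
  have Y: "integrable M Y" "integrable M (\<lambda>x. (Y x)\<^sup>2)" "M.expectation Y = 0"
    using X X2 by (simp_all add: Y_def power2_diff M.prob_space \<mu>_def)
  have XM: "X \<in> borel_measurable M" and YM: "Y \<in> borel_measurable M"
    using X Y by auto
  have comp: "distr ?P M (\<lambda>\<omega>. \<omega> i) = M" if "i \<in> {1..n}" for i
    using distr_PiM_component[of "{1..n}" "\<lambda>_. M" i] that M by simp
  have int_comp: "integrable ?P (\<lambda>\<omega>. f (\<omega> i))" and E_comp: "P.expectation (\<lambda>\<omega>. f (\<omega> i)) = M.expectation f"
    if "i \<in> {1..n}" "integrable M f" for i and f :: "'a \<Rightarrow> real"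
  proof -
    have m: "(\<lambda>\<omega>. \<omega> i) \<in> ?P \<rightarrow>\<^sub>M M"
      using measurable_component_singleton[of i "{1..n}" "\<lambda>_. M"] that(1) by simp
    have f: "f \<in> borel_measurable M" using that by auto
    show "integrable ?P (\<lambda>\<omega>. f (\<omega> i))"
      using integrable_distr_eq[OF m f] comp[OF that(1)] that(2) by simp
    show "P.expectation (\<lambda>\<omega>. f (\<omega> i)) = M.expectation f"
      using integral_distr[OF m f] comp[OF that(1)] by simp
  qed
  have cross: "integrable ?P (\<lambda>\<omega>. Y (\<omega> i) * Y (\<omega> j)) \<and>
      P.expectation (\<lambda>\<omega>. Y (\<omega> i) * Y (\<omega> j)) = (if i = j then M.expectation (\<lambda>x. (Y x)\<^sup>2) else 0)"
    if ij: "i \<in> {1..n}" "j \<in> {1..n}" for i j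
  proof (cases "i = j")
    case True
    then show ?thesis
      using int_comp[OF ij(1) Y(2)] E_comp[OF ij(1) Y(2)] by (simp add: power2_eq_square)
  next
    case False
    \<comment> \<open>The constant 1 at all other coordinates turns the cross term into a product
      over the full index set, to which the product formula for \<open>P\<close> applies.\<close>
    define f where "f k = (if k \<in> {i, j} then Y else (\<lambda>_. 1))" for k
    have f: "integrable M (f k)" for k by (simp add: f_def Y)
    have eq: "(\<Prod>k\<in>{1..n}. f k (\<omega> k)) = Y (\<omega> i) * Y (\<omega> j)" for \<omega>
    proof -
      have "(\<Prod>k\<in>{1..n}. f k (\<omega> k)) = (\<Prod>k\<in>{i, j}. f k (\<omega> k))"
        using ij by (intro prod.mono_neutral_right) (auto simp: f_def)
      then show ?thesis using False by (simp add: f_def)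
    qed
    have "(\<Prod>k\<in>{1..n}. M.expectation (f k)) = 0"
      using ij by (intro prod_zero) (auto simp: f_def Y intro!: bexI[of _ i])
    then show ?thesis
      using P.product_integral_prod[of "{1..n}" f, OF _ f, unfolded eq]
        P.product_integrable_prod[of "{1..n}" f, OF _ f, unfolded eq] False
      by simp
  qed
  have "P.expectation (\<lambda>\<omega>. (1 / real n) * (\<Sum>i=1..n. X (\<omega> i))) = (1 / real n) * (\<Sum>i=1..n. \<mu>)"
    using int_comp[OF _ X] E_comp[OF _ X] by (simp add: \<mu>_def)
  also have "\<dots> = \<mu>" using n by simp
  finally have mean: "P.expectation (\<lambda>\<omega>. (1 / real n) * (\<Sum>i=1..n. X (\<omega> i))) = \<mu>" .
  have sq: "((1 / real n) * (\<Sum>i=1..n. X (\<omega> i)) - \<mu>)\<^sup>2 =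
      (1 / real n)\<^sup>2 * (\<Sum>i=1..n. \<Sum>j=1..n. Y (\<omega> i) * Y (\<omega> j))" for \<omega>
  proof -
    have "(1 / real n) * (\<Sum>i=1..n. X (\<omega> i)) - \<mu> = (1 / real n) * (\<Sum>i=1..n. Y (\<omega> i))"
      using n by (simp add: Y_def sum_subtractf field_simps)
    then show ?thesis
      by (simp add: power_mult_distrib power2_eq_square sum_product)
  qed
  have "P.variance (\<lambda>\<omega>. (1 / real n) * (\<Sum>i=1..n. X (\<omega> i))) =
      (1 / real n)\<^sup>2 * P.expectation (\<lambda>\<omega>. \<Sum>i=1..n. \<Sum>j=1..n. Y (\<omega> i) * Y (\<omega> j))"
    unfolding mean sq by simp
  also have "P.expectation (\<lambda>\<omega>. \<Sum>i=1..n. \<Sum>j=1..n. Y (\<omega> i) * Y (\<omega> j)) =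
      (\<Sum>i=1..n. \<Sum>j=1..n. P.expectation (\<lambda>\<omega>. Y (\<omega> i) * Y (\<omega> j)))"
    by (subst Bochner_Integration.integral_sum,
        intro Bochner_Integration.integrable_sum conjunct1[OF cross], assumption+,
        intro sum.cong refl Bochner_Integration.integral_sum conjunct1[OF cross])
  also have "\<dots> = (\<Sum>i=1..n. \<Sum>j=1..n. if i = j then M.expectation (\<lambda>x. (Y x)\<^sup>2) else 0)"
    by (intro sum.cong refl conjunct2[OF cross])
  also have "\<dots> = (\<Sum>i=1..n. M.expectation (\<lambda>x. (Y x)\<^sup>2))"
    by (intro sum.cong) auto
  also have "\<dots> = n * M.variance X"
    by (simp add: Y_def \<mu>_def)
  finally show ?thesis using n by (simp add: power2_eq_square)
qed

text \<open>Integrating against a bind is iterated integration; the inner integral is over one coin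
  of bias \<open>A c\<close>, hence a two-term average. Boundedness by \<open>C\<close> makes this
  available for real-valued \<open>f\<close>.\<close>

lemma
  assumes D: "consistent Z F D"
    and A: "\<And>c. c \<in> set_pmf F \<Longrightarrow> 0 < A c \<and> A c \<le> 1"
  shows prob_space_agent_law: "prob_space (agent_law D A)"
    and integrable_agent_law: "f \<in> borel_measurable (D \<Otimes>\<^sub>M count_space UNIV) \<Longrightarrow>
      (\<And>x. x \<in> space (D \<Otimes>\<^sub>M count_space UNIV) \<Longrightarrow> \<bar>f x\<bar> \<le> C) \<Longrightarrow>
      integrable (agent_law D A) (f :: _ \<Rightarrow> real)"
    and integral_agent_law: "f \<in> borel_measurable (D \<Otimes>\<^sub>M count_space UNIV) \<Longrightarrow>
      (\<And>x. x \<in> space (D \<Otimes>\<^sub>M count_space UNIV) \<Longrightarrow> \<bar>f x\<bar> \<le> C) \<Longrightarrow>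
      (\<integral>x. f x \<partial>agent_law D A) =
        (\<integral>zc. f (zc, True) * A (snd zc) + f (zc, False) * (1 - A (snd zc)) \<partial>D)"
proof -
  interpret D: prob_space D using D by (simp add: consistent_def)
  let ?K = "D \<Otimes>\<^sub>M count_space (UNIV :: bool set)"
  let ?N = "\<lambda>zc. distr (measure_pmf (bernoulli_pmf (A (snd zc)))) ?K (\<lambda>b. (zc, b))"
  have [measurable_cong]: "sets D = sets (Z \<Otimes>\<^sub>M count_space (set_pmf F))"
    using D by (simp add: consistent_def)
  then have sp: "space D = space (Z \<Otimes>\<^sub>M count_space (set_pmf F))"
    by (rule sets_eq_imp_space_eq)
  have sndS: "snd zc \<in> set_pmf F" if "zc \<in> space D" for zc
    using that by (auto simp: sp space_pair_measure)
  \<comment> \<open>The kernel factors through the cost, and on the discrete cost space its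
    measurability is immediate.\<close>
  have "snd \<in> D \<rightarrow>\<^sub>M count_space (set_pmf F)" by measurable
  moreover have "(\<lambda>c. measure_pmf (bernoulli_pmf (A c))) \<in> count_space (set_pmf F) \<rightarrow>\<^sub>M subprob_algebra (count_space UNIV)"
    by (auto simp: measurable_count_space_eq1 space_subprob_algebra measure_pmf.subprob_space_axioms)
  ultimately have "(\<lambda>zc. measure_pmf (bernoulli_pmf (A (snd zc)))) \<in> D \<rightarrow>\<^sub>M subprob_algebra (count_space UNIV)"
    by (rule measurable_compose)
  then have N: "?N \<in> D \<rightarrow>\<^sub>M subprob_algebra ?K"
    by (intro measurable_distr2) auto
  have prN: "prob_space (?N zc)" if "zc \<in> space D" for zc
    using that by (intro measure_pmf.prob_space_distr) (auto simp: space_pair_measure)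
  show "prob_space (agent_law D A)"
    unfolding agent_law_def by (intro D.prob_space_bind[OF _ N] AE_I2 prN)
  have mass: "AE zc in D. emeasure (?N zc) (space (?N zc)) \<le> ennreal 1"
    using prob_space.emeasure_space_1[OF prN] by (intro AE_I2) simp
  {
    assume f: "f \<in> borel_measurable ?K" and b: "\<And>x. x \<in> space ?K \<Longrightarrow> \<bar>f x\<bar> \<le> C"
    show "integrable (agent_law D A) f"
      unfolding agent_law_def by (rule integrable_bind[OF f b N D.finite_measure_axioms mass])
    have "(\<integral>x. f x \<partial>agent_law D A) = (\<integral>zc. (\<integral>x. f x \<partial>?N zc) \<partial>D)"
      unfolding agent_law_def by (rule integral_bind[OF f b N D.finite_measure_axioms mass])
    also have "\<dots> = (\<integral>zc. f (zc, True) * A (snd zc) + f (zc, False) * (1 - A (snd zc)) \<partial>D)"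
    proof (rule Bochner_Integration.integral_cong[OF refl])
      fix zc assume zc: "zc \<in> space D"
      have "(\<integral>x. f x \<partial>?N zc) = (\<integral>b. f (zc, b) \<partial>measure_pmf (bernoulli_pmf (A (snd zc))))"
        using zc f by (intro integral_distr) (auto simp: space_pair_measure)
      then show "(\<integral>x. f x \<partial>?N zc) = f (zc, True) * A (snd zc) + f (zc, False) * (1 - A (snd zc))"
        using A[OF sndS[OF zc]] by simp
    qed
    finally show "(\<integral>x. f x \<partial>agent_law D A) = (\<integral>zc. f (zc, True) * A (snd zc) + f (zc, False) * (1 - A (snd zc)) \<partial>D)" .
  }
qed

text \<open>Each agent contributes \<open>X\<close>, the value \<open>m z / A c\<close> if sampled
  and 0 otherwise. Averaging over the coin multiplies by \<open>A c\<close>: this cancels the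
  denominator in the mean of \<open>X\<close> and leaves one factor \<open>1 / A c\<close> in its
  second moment.\<close>

lemma HT_variance_consistent:
  assumes D: "consistent Z F D" and F: "finite (set_pmf F)"
    and A: "\<And>c. c \<in> set_pmf F \<Longrightarrow> 0 < A c \<and> A c \<le> 1"
    and m: "m \<in> borel_measurable Z" and m01: "\<And>z. z \<in> space Z \<Longrightarrow> 0 \<le> m z \<and> m z \<le> 1"
    and n: "n \<ge> 1"
  shows "HT_variance m n D A =
    (1 / real n) * ((\<integral>zc. (m (fst zc))\<^sup>2 / A (snd zc) \<partial>D) - (\<integral>zc. m (fst zc) \<partial>D)\<^sup>2)"
proof -
  interpret D: prob_space D using D by (simp add: consistent_def)
  let ?K = "D \<Otimes>\<^sub>M count_space (UNIV :: bool set)"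
  interpret L: prob_space "agent_law D A" by (rule prob_space_agent_law[OF D A])
  have [measurable_cong]: "sets D = sets (Z \<Otimes>\<^sub>M count_space (set_pmf F))"
    using D by (simp add: consistent_def)
  then have sp: "space D = space (Z \<Otimes>\<^sub>M count_space (set_pmf F))"
    by (rule sets_eq_imp_space_eq)
  have inD: "fst zc \<in> space Z \<and> snd zc \<in> set_pmf F" if "zc \<in> space D" for zc
    using that by (auto simp: sp space_pair_measure)
  have [measurable]: "m \<in> borel_measurable Z" by fact
  define X where "X x = m (fst (fst x)) * of_bool (snd x) / A (snd (fst x))" for x
  have A_meas: "A \<in> borel_measurable (count_space (set_pmf F))" by simp
  have [measurable]: "(\<lambda>zc. A (snd zc)) \<in> borel_measurable D"
    by (rule measurable_compose[OF _ A_meas]) measurable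
  have XM[measurable]: "X \<in> borel_measurable ?K" unfolding X_def by measurable
  \<comment> \<open>A uniform bound on \<open>X\<close>: the sum of all \<open>1 / A c\<close>
    dominates each of them, and the support is finite.\<close>
  define C where "C = (\<Sum>c\<in>set_pmf F. 1 / A c)"
  have AC: "1 / A c \<le> C" if "c \<in> set_pmf F" for c
    unfolding C_def using F A that by (intro member_le_sum) (auto intro: less_imp_le)
  have XC: "\<bar>X x\<bar> \<le> C" and C0: "0 \<le> C" if "x \<in> space ?K" for x
  proof -
    have x: "fst (fst x) \<in> space Z" "snd (fst x) \<in> set_pmf F"
      using that inD[of "fst x"] by (auto simp: space_pair_measure)
    have "\<bar>X x\<bar> \<le> 1 / A (snd (fst x))"
      using m01[OF x(1)] A[OF x(2)] by (auto simp: X_def divide_right_mono)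
    moreover have "0 \<le> 1 / A (snd (fst x))" using A[OF x(2)] by simp
    moreover have "1 / A (snd (fst x)) \<le> C" by (rule AC[OF x(2)])
    ultimately show "\<bar>X x\<bar> \<le> C" "0 \<le> C" by linarith+
  qed
  have X2C: "\<bar>(X x)\<^sup>2\<bar> \<le> C\<^sup>2" if "x \<in> space ?K" for x
    using XC[OF that] by (simp add: abs_le_square_iff[symmetric])
  have X2M: "(\<lambda>x. (X x)\<^sup>2) \<in> borel_measurable ?K" by measurable
  have intX: "integrable (agent_law D A) X" "integrable (agent_law D A) (\<lambda>x. (X x)\<^sup>2)"
    using integrable_agent_law[OF D A XM XC] integrable_agent_law[OF D A X2M X2C] by auto
  have "L.expectation X = (\<integral>zc. m (fst zc) \<partial>D)"
    by (rule trans[OF integral_agent_law[where A = A, OF D A XM XC]])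
      (use inD A in \<open>auto simp: X_def less_le intro!: Bochner_Integration.integral_cong\<close>)
  moreover have "L.expectation (\<lambda>x. (X x)\<^sup>2) = (\<integral>zc. (m (fst zc))\<^sup>2 / A (snd zc) \<partial>D)"
    by (rule trans[OF integral_agent_law[where A = A, OF D A X2M X2C]])
      (use inD A in \<open>auto simp: X_def less_le power2_eq_square intro!: Bochner_Integration.integral_cong\<close>)
  ultimately have var: "L.variance X = (\<integral>zc. (m (fst zc))\<^sup>2 / A (snd zc) \<partial>D) - (\<integral>zc. m (fst zc) \<partial>D)\<^sup>2"
    using L.variance_eq[OF intX] by simp
  have HT: "HT_estimator m n A = (\<lambda>\<omega>. (1 / real n) * (\<Sum>i=1..n. X (\<omega> i)))"
    by (rule ext) (auto simp: HT_estimator_def X_def sample_set_def indicator_def of_bool_def intro!: sum.cong)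
  show ?thesis
    unfolding HT_variance_def population_law_def HT
      variance_mean_PiM[OF L.prob_space_axioms n intX] var ..
qed

section \<open>Enumeration of the costs and reduction to binary data\<close>

lemma bij_betw_cost:
  assumes "finite (set_pmf F)"
  shows "bij_betw (cost F) {1..num_costs F} (set_pmf F)"
proof -
  let ?l = "sorted_list_of_set (set_pmf F)"
  have "bij_betw ((!) ?l) {..<num_costs F} (set_pmf F)"
    using assms by (intro bij_betw_nth) (auto simp: num_costs_def)
  moreover have "bij_betw (\<lambda>t. t - 1) {1..num_costs F} {..<num_costs F}"
    by (rule bij_betw_byWitness[where f' = Suc]) auto
  ultimately have "bij_betw ((!) ?l \<circ> (\<lambda>t. t - 1)) {1..num_costs F} (set_pmf F)"
    by (rule bij_betw_trans[rotated])
  then show ?thesis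
    by (rule bij_betw_cong[THEN iffD1, rotated]) (auto simp: cost_def)
qed

lemma sum_cost:
  assumes "finite (set_pmf F)"
  shows "(\<Sum>t=1..num_costs F. g (cost F t)) = (\<Sum>c\<in>set_pmf F. g c)"
  by (rule sum.reindex_bij_betw[OF bij_betw_cost[OF assms]])

text \<open>\<open>payoff F A q\<close> is \<open>n\<close> times the estimator's variance when \<open>m\<close> is binary and \<open>q c\<close> is the
  conditional mean of \<open>m\<close> given cost \<open>c\<close>.\<close>

definition payoff :: "real pmf \<Rightarrow> (real \<Rightarrow> real) \<Rightarrow> (real \<Rightarrow> real) \<Rightarrow> real" where
  "payoff F A q = (\<Sum>c\<in>set_pmf F. pmf F c * (q c / A c)) - (\<Sum>c\<in>set_pmf F. pmf F c * q c)\<^sup>2"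

text \<open>Take for \<open>q c\<close> the conditional mean of \<open>m\<close> given cost
  \<open>c\<close>. The mean of \<open>m\<close> then depends on \<open>q\<close> alone, and
  \<open>m^2 \<le> m\<close> bounds the second moment by the value it would have for binary
  data.\<close>

lemma HT_variance_le_payoff:
  assumes D: "consistent Z F D" and F: "finite (set_pmf F)"
    and A: "\<And>c. c \<in> set_pmf F \<Longrightarrow> 0 < A c \<and> A c \<le> 1"
    and m: "m \<in> borel_measurable Z" and m01: "\<And>z. z \<in> space Z \<Longrightarrow> 0 \<le> m z \<and> m z \<le> 1"
    and n: "n \<ge> 1"
  shows "\<exists>q. (\<forall>c\<in>set_pmf F. 0 \<le> q c \<and> q c \<le> 1) \<and> HT_variance m n D A \<le> payoff F A q / real n"
proof -
  interpret D: prob_space D using D by (simp add: consistent_def)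
  have [measurable_cong]: "sets D = sets (Z \<Otimes>\<^sub>M count_space (set_pmf F))"
    using D by (simp add: consistent_def)
  then have sp: "space D = space (Z \<Otimes>\<^sub>M count_space (set_pmf F))"
    by (rule sets_eq_imp_space_eq)
  have inD: "fst zc \<in> space Z \<and> snd zc \<in> set_pmf F" if "zc \<in> space D" for zc
    using that by (auto simp: sp space_pair_measure)
  have [measurable]: "m \<in> borel_measurable Z" by fact
  have lift: "(\<lambda>zc. h (snd zc)) \<in> borel_measurable D" for h :: "real \<Rightarrow> real"
  proof -
    have "h \<in> borel_measurable (count_space (set_pmf F))" by simp
    then show ?thesis by (rule measurable_compose[rotated]) measurable
  qed
  note [measurable] = lift[of A] lift[of "indicator {c}" for c]
  \<comment> \<open>The unnormalised conditional mean; dividing by \<open>pmf F c\<close> gives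
    \<open>q c\<close> below.\<close>
  define w where "w c = (\<integral>zc. m (fst zc) * indicator {c} (snd zc) \<partial>D)" for c
  have int_ind: "integrable D (\<lambda>zc. indicator {c} (snd zc) :: real)" for c
    by (rule D.integrable_const_bound[where B = 1]) auto
  have int_w: "integrable D (\<lambda>zc. m (fst zc) * indicator {c} (snd zc))" for c
    by (rule D.integrable_const_bound[where B = 1]) (use inD m01 in \<open>auto intro!: AE_I2 simp: indicator_def\<close>)
  have "(\<lambda>zc. snd zc) \<in> D \<rightarrow>\<^sub>M count_space UNIV"
    by (rule measurable_compose[of snd D "count_space (set_pmf F)"]) auto
  then have ind: "(\<integral>zc. indicator {c} (snd zc) \<partial>D) = pmf F c" for c
    using integral_distr[of snd D "count_space UNIV" "indicator {c} :: real \<Rightarrow> real"] D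
    by (simp add: consistent_def pmf.rep_eq)
  have w01: "0 \<le> w c \<and> w c \<le> pmf F c" for c
  proof
    show "0 \<le> w c" unfolding w_def
      using inD m01 by (intro integral_nonneg_AE AE_I2) (auto simp: indicator_def)
    have "w c \<le> (\<integral>zc. indicator {c} (snd zc) \<partial>D)"
      unfolding w_def using inD m01 by (intro integral_mono int_ind int_w) (auto simp: indicator_def)
    then show "w c \<le> pmf F c" by (simp add: ind)
  qed
  \<comment> \<open>The indicators of the finitely many costs partition the space, so every integral
    of \<open>m\<close> against a function of the cost is a finite sum with weights
    \<open>w\<close>.\<close>
  have decomp: "integrable D (\<lambda>zc. m (fst zc) * h (snd zc)) \<and>
      (\<integral>zc. m (fst zc) * h (snd zc) \<partial>D) = (\<Sum>c\<in>set_pmf F. w c * h c)" for h :: "real \<Rightarrow> real"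
  proof -
    have eq: "m (fst zc) * h (snd zc) = (\<Sum>c\<in>set_pmf F. (m (fst zc) * indicator {c} (snd zc)) * h c)"
      if "zc \<in> space D" for zc
    proof -
      have "(\<Sum>c\<in>set_pmf F. (m (fst zc) * indicator {c} (snd zc)) * h c) =
          (\<Sum>c\<in>{snd zc}. (m (fst zc) * indicator {c} (snd zc)) * h c)"
        using F inD[OF that] by (intro sum.mono_neutral_right) (auto simp: indicator_def)
      then show ?thesis by simp
    qed
    have "integrable D (\<lambda>zc. \<Sum>c\<in>set_pmf F. (m (fst zc) * indicator {c} (snd zc)) * h c)"
      using int_w by auto
    moreover have "(\<integral>zc. (\<Sum>c\<in>set_pmf F. (m (fst zc) * indicator {c} (snd zc)) * h c) \<partial>D) =
        (\<Sum>c\<in>set_pmf F. w c * h c)"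
      using int_w by (subst Bochner_Integration.integral_sum) (auto simp: w_def)
    ultimately show ?thesis
      by (simp add: eq cong: Bochner_Integration.integrable_cong Bochner_Integration.integral_cong)
  qed
  define q where "q c = w c / pmf F c" for c
  have pq: "pmf F c * q c = w c" if "c \<in> set_pmf F" for c
    using pmf_positive[OF that] by (simp add: q_def)
  have mean: "(\<integral>zc. m (fst zc) \<partial>D) = (\<Sum>c\<in>set_pmf F. pmf F c * q c)"
    using decomp[of "\<lambda>_. 1"] pq by simp
  have "(\<integral>zc. (m (fst zc))\<^sup>2 / A (snd zc) \<partial>D) \<le> (\<integral>zc. m (fst zc) * (1 / A (snd zc)) \<partial>D)"
  proof (rule integral_mono_AE')
    show "integrable D (\<lambda>zc. m (fst zc) * (1 / A (snd zc)))"
      using decomp[of "\<lambda>c. 1 / A c"] by blast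
    have "(m (fst zc))\<^sup>2 / A (snd zc) \<le> m (fst zc) * (1 / A (snd zc))" if "zc \<in> space D" for zc
      using m01[of "fst zc"] A[of "snd zc"] inD[OF that]
      by (auto simp: power2_eq_square mult_left_le intro!: divide_right_mono)
    then show "AE zc in D. (m (fst zc))\<^sup>2 / A (snd zc) \<le> m (fst zc) * (1 / A (snd zc))" by auto
    show "AE zc in D. 0 \<le> m (fst zc) * (1 / A (snd zc))"
      using inD m01 A by (auto intro!: AE_I2 mult_nonneg_nonneg simp: less_imp_le)
  qed
  also have "\<dots> = (\<Sum>c\<in>set_pmf F. w c * (1 / A c))"
    using decomp[of "\<lambda>c. 1 / A c"] by blast
  also have "\<dots> = (\<Sum>c\<in>set_pmf F. pmf F c * (q c / A c))"
    by (intro sum.cong refl) (simp flip: pq)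
  finally have "HT_variance m n D A \<le> payoff F A q / real n"
    unfolding HT_variance_consistent[where A = A, OF D F A m m01 n, simplified] payoff_def
    by (simp add: mean divide_right_mono)
  moreover have "\<forall>c\<in>set_pmf F. 0 \<le> q c \<and> q c \<le> 1"
  proof
    fix c assume "c \<in> set_pmf F"
    then show "0 \<le> q c \<and> q c \<le> 1"
      using w01[of c] pmf_positive[of c F] by (simp add: q_def)
  qed
  ultimately show ?thesis by blast
qed

text \<open>Draw the cost from \<open>F\<close> and then \<open>z1\<close> with probability
  \<open>q c\<close>, otherwise \<open>z0\<close>. Here \<open>m\<close> takes only the values 0 and
  1, so \<open>m^2 = m\<close> and nothing is lost in the second moment.\<close>

lemma payoff_attained:
  assumes F: "finite (set_pmf F)"
    and A: "\<And>c. c \<in> set_pmf F \<Longrightarrow> 0 < A c \<and> A c \<le> 1"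
    and m: "m \<in> borel_measurable Z" and m01: "\<And>z. z \<in> space Z \<Longrightarrow> 0 \<le> m z \<and> m z \<le> 1"
    and m0: "\<exists>z\<in>space Z. m z = 0" and m1: "\<exists>z\<in>space Z. m z = 1" and n: "n \<ge> 1"
    and q: "\<And>c. c \<in> set_pmf F \<Longrightarrow> 0 \<le> q c \<and> q c \<le> 1"
  shows "\<exists>D. consistent Z F D \<and> HT_variance m n D A = payoff F A q / real n"
proof -
  obtain z0 z1 where z: "z0 \<in> space Z" "m z0 = 0" "z1 \<in> space Z" "m z1 = 1"
    using m0 m1 by auto
  obtain c0 where c0: "c0 \<in> set_pmf F" using set_pmf_not_empty[of F] by blast
  define P where "P = bind_pmf F (\<lambda>c. map_pmf (\<lambda>b. (b, c)) (bernoulli_pmf (q c)))"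
  \<comment> \<open>A retraction onto the support: \<open>h\<close> must land in the space of
    \<open>?K\<close> for every pair, including pairs of probability zero. On the support
    \<open>r\<close> is the identity, so the law is unchanged.\<close>
  define r where "r c = (if c \<in> set_pmf F then c else c0)" for c
  define h where "h x = (if fst x then z1 else z0, r (snd x))" for x
  let ?K = "Z \<Otimes>\<^sub>M count_space (set_pmf F)"
  define D where "D = distr (measure_pmf P) ?K h"
  have h: "h \<in> measure_pmf P \<rightarrow>\<^sub>M ?K"
    using z c0 by (auto simp: h_def r_def space_pair_measure)
  have snd: "snd \<in> ?K \<rightarrow>\<^sub>M count_space UNIV"
    by (rule measurable_compose[of snd ?K "count_space (set_pmf F)"]) auto
  have "distr D (count_space UNIV) snd = distr (measure_pmf P) (count_space UNIV) (\<lambda>x. r (snd x))"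
    unfolding D_def using distr_distr[OF snd h] by (simp add: comp_def h_def)
  also have "\<dots> = measure_pmf (map_pmf (\<lambda>x. r (snd x)) P)"
    by (simp add: map_pmf_rep_eq)
  also have "map_pmf (\<lambda>x. r (snd x)) P = map_pmf r F"
    by (simp add: P_def map_bind_pmf map_pmf_comp map_pmf_const bind_return_pmf' flip: map_pmf_def)
  also have "\<dots> = F"
    by (simp add: r_def cong: map_pmf_cong)
  finally have D: "consistent Z F D"
    using measure_pmf.prob_space_distr[OF h] by (simp add: consistent_def D_def)
  have E: "(\<integral>zc. g zc \<partial>D) = (\<Sum>c\<in>set_pmf F. pmf F c * (g (z1, c) * q c + g (z0, c) * (1 - q c)))"
    if "g \<in> borel_measurable ?K" for g :: "_ \<Rightarrow> real"
  proof -
    have "(\<integral>zc. g zc \<partial>D) = (\<integral>x. g (h x) \<partial>measure_pmf P)"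
      unfolding D_def by (rule integral_distr[OF h that])
    also have "\<dots> = (\<Sum>c\<in>set_pmf F. pmf F c *\<^sub>R
        (\<integral>x. g (h x) \<partial>measure_pmf (map_pmf (\<lambda>b. (b, c)) (bernoulli_pmf (q c)))))"
      unfolding P_def using F by (intro pmf_expectation_bind) auto
    also have "\<dots> = (\<Sum>c\<in>set_pmf F. pmf F c * (g (z1, c) * q c + g (z0, c) * (1 - q c)))"
      using q by (intro sum.cong) (auto simp: h_def r_def)
    finally show ?thesis .
  qed
  have [measurable]: "m \<in> borel_measurable Z" by fact
  have "A \<in> borel_measurable (count_space (set_pmf F))" by simp
  then have [measurable]: "(\<lambda>zc. A (snd zc)) \<in> borel_measurable ?K"
    by (rule measurable_compose[rotated]) measurable
  have "HT_variance m n D A = payoff F A q / real n"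
    unfolding HT_variance_consistent[where A = A, OF D F A m m01 n, simplified] payoff_def
    by (subst E, measurable, subst E, measurable) (simp add: z)
  with D show ?thesis by blast
qed

section \<open>Saddle points characterise the optimal rule\<close>

text \<open>The conditions \<open>q_ge\<close> and \<open>q_eq\<close> are the first-order
  conditions for \<open>S\<close> minimising the payoff against \<open>q\<close>, with multiplier
  \<open>\<mu>\<close> for the budget and complementary slackness for the bound 1 on the rule.
  Likewise \<open>S_ge\<close> and \<open>S_eq\<close> say that \<open>q\<close> is a best response
  to \<open>S\<close> under the bound 1. Hence no distribution exceeds \<open>V\<close> against
  \<open>S\<close>, and \<open>q\<close> holds every feasible rule to at least
  \<open>V\<close>.\<close>

lemma optimal_iff_saddle_point:
  assumes m: "m \<in> borel_measurable Z" and m01: "\<And>z. z \<in> space Z \<Longrightarrow> 0 \<le> m z \<and> m z \<le> 1"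
    and m0: "\<exists>z\<in>space Z. m z = 0" and m1: "\<exists>z\<in>space Z. m z = 1" and n: "n \<ge> 1"
    and F: "finite (set_pmf F)" and pos: "set_pmf F \<subseteq> {0<..}"
    and S: "\<And>c. c \<in> set_pmf F \<Longrightarrow> 0 < S c \<and> S c \<le> 1" and anti: "antimono_on (set_pmf F) S"
    and budget: "(\<Sum>c\<in>set_pmf F. pmf F c * c * S c) = Bbar"
    and q: "\<And>c. c \<in> set_pmf F \<Longrightarrow> 0 < q c \<and> q c \<le> 1" and \<mu>: "0 < \<mu>"
    and q_ge: "\<And>c. c \<in> set_pmf F \<Longrightarrow> \<mu> * c * (S c)\<^sup>2 \<le> q c"
    and q_eq: "\<And>c. c \<in> set_pmf F \<Longrightarrow> S c = 1 \<or> q c = \<mu> * c * (S c)\<^sup>2"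
    and \<theta>: "\<theta> = (\<Sum>c\<in>set_pmf F. pmf F c * q c)"
    and S_ge: "\<And>c. c \<in> set_pmf F \<Longrightarrow> 2 * \<theta> \<le> 1 / S c"
    and S_eq: "\<And>c. c \<in> set_pmf F \<Longrightarrow> q c = 1 \<or> 1 / S c = 2 * \<theta>"
  shows "optimal Z m n F Bbar A \<longleftrightarrow> (\<forall>c\<in>set_pmf F. A c = S c)"
proof -
  have feas: "feasible F Bbar A \<longleftrightarrow> (\<forall>c\<in>set_pmf F. 0 < A c \<and> A c \<le> 1) \<and>
      antimono_on (set_pmf F) A \<and> (\<Sum>c\<in>set_pmf F. pmf F c * c * A c) \<le> Bbar" for A
    unfolding feasible_def prob_cost_def
    using sum_cost[OF F, of "\<lambda>c. pmf F c * c * A c"] by simp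
  define V where "V = payoff F S q / real n"
  have upper: "worst_variance Z m n F A \<le> ereal V" if "\<forall>c\<in>set_pmf F. A c = S c" for A
    unfolding worst_variance_def
  proof (rule SUP_least)
    fix D assume "D \<in> {D. consistent Z F D}"
    then have D: "consistent Z F D" by simp
    have A01: "0 < A c \<and> A c \<le> 1" if "c \<in> set_pmf F" for c
      using S[OF that] \<open>\<forall>c\<in>set_pmf F. A c = S c\<close> that by simp
    obtain r where r: "\<forall>c\<in>set_pmf F. 0 \<le> r c \<and> r c \<le> 1"
      and le: "HT_variance m n D A \<le> payoff F A r / real n"
      using HT_variance_le_payoff[where A = A, OF D F A01 m m01 n] by blast
    let ?\<rho> = "\<Sum>c\<in>set_pmf F. pmf F c * r c"
    have "payoff F A r - payoff F S q =
        (\<Sum>c\<in>set_pmf F. pmf F c * ((r c - q c) * (1 / S c))) - (?\<rho>\<^sup>2 - \<theta>\<^sup>2)"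
      using that by (simp add: payoff_def \<theta> sum_subtractf algebra_simps diff_divide_distrib)
    \<comment> \<open>Concavity in \<open>q\<close> made explicit:
      \<open>?\<rho>^2 - \<theta>^2\<close> is the tangent term
      \<open>2 * \<theta> * (?\<rho> - \<theta>)\<close> plus a square. The linear part is at most
      zero by the conditions on \<open>S\<close>.\<close>
    also have "\<dots> = (\<Sum>c\<in>set_pmf F. pmf F c * ((r c - q c) * (1 / S c - 2 * \<theta>))) - (?\<rho> - \<theta>)\<^sup>2"
    proof -
      have "(\<Sum>c\<in>set_pmf F. pmf F c * ((r c - q c) * (1 / S c - 2 * \<theta>))) =
          (\<Sum>c\<in>set_pmf F. pmf F c * ((r c - q c) * (1 / S c))) -
          2 * \<theta> * (\<Sum>c\<in>set_pmf F. pmf F c * (r c - q c))"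
        unfolding sum_distrib_left sum_subtractf[symmetric]
        by (intro sum.cong refl) (simp add: algebra_simps)
      also have "(\<Sum>c\<in>set_pmf F. pmf F c * (r c - q c)) = ?\<rho> - \<theta>"
        by (simp add: \<theta> sum_subtractf right_diff_distrib)
      finally show ?thesis by (simp add: power2_eq_square algebra_simps)
    qed
    also have "\<dots> \<le> 0"
    proof -
      have "pmf F c * ((r c - q c) * (1 / S c - 2 * \<theta>)) \<le> 0" if c: "c \<in> set_pmf F" for c
      proof -
        have "(r c - q c) * (1 / S c - 2 * \<theta>) \<le> 0"
          using S_eq[OF c]
        proof
          assume "q c = 1"
          then show ?thesis using S_ge[OF c] r c by (intro mult_nonpos_nonneg) auto
        qed simp
        then show ?thesis by (simp add: mult_nonneg_nonpos)
      qed
      then have "(\<Sum>c\<in>set_pmf F. pmf F c * ((r c - q c) * (1 / S c - 2 * \<theta>))) \<le> 0"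
        by (rule sum_nonpos)
      then show ?thesis by (smt (verit) zero_le_power2)
    qed
    finally have "payoff F A r / real n \<le> V" by (simp add: V_def divide_right_mono)
    with le show "ereal (HT_variance m n D A) \<le> ereal V" by simp
  qed
  have gap: "payoff F S q \<le> payoff F A q \<and> (payoff F A q \<le> payoff F S q \<longrightarrow> (\<forall>c\<in>set_pmf F. A c = S c))"
    if A: "feasible F Bbar A" for A
  proof -
    have A01: "0 < A c \<and> A c \<le> 1" if "c \<in> set_pmf F" for c
      using A that by (auto simp: feas)
    \<comment> \<open>The excess at cost \<open>c\<close> of the Lagrangian at \<open>A\<close> over
      its value at \<open>S\<close>. It vanishes only for \<open>A c = S c\<close> because
      \<open>q c\<close> is positive, which is where uniqueness comes from.\<close>
    define e where "e c = (q c / A c + \<mu> * c * A c) - (q c / S c + \<mu> * c * S c)" for c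
    have e: "0 \<le> e c \<and> (e c = 0 \<longrightarrow> A c = S c)" if c: "c \<in> set_pmf F" for c
    proof -
      have a: "0 < A c" "A c \<le> 1" "0 < S c" "0 < c" "0 < q c"
        using A01[OF c] S[OF c] q[OF c] pos c by auto
      have e_eq: "e c = (S c - A c) * (q c / (A c * S c) - \<mu> * c)"
        using a by (simp add: e_def field_simps)
      show ?thesis
        using q_eq[OF c]
      proof
        assume S1: "S c = 1"
        have le: "\<mu> * c \<le> q c" using q_ge[OF c] S1 by simp
        show ?thesis
        proof (cases "A c = 1")
          case False
          then have A1: "A c < 1" using a by simp
          then have "q c < q c / A c" using a by (simp add: field_simps)
          then have "0 < e c"
            unfolding e_eq S1 using le A1 by (intro mult_pos_pos) auto
          then show ?thesis by simp
        qed (simp add: e_eq S1)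
      next
        assume "q c = \<mu> * c * (S c)\<^sup>2"
        then have "e c = \<mu> * c * (S c - A c)\<^sup>2 / A c"
          using a unfolding e_eq by (simp add: field_simps power2_eq_square)
        then show ?thesis using a \<mu> by auto
      qed
    qed
    \<comment> \<open>\<open>S\<close> spends the budget exactly and \<open>A\<close> at most that
      much, so the multiplier term is nonpositive and the payoff gap dominates the sum of the
      excesses.\<close>
    have "(\<Sum>c\<in>set_pmf F. pmf F c * e c) = payoff F A q - payoff F S q +
        \<mu> * ((\<Sum>c\<in>set_pmf F. pmf F c * c * A c) - Bbar)"
      unfolding payoff_def e_def budget[symmetric]
      by (simp add: algebra_simps sum_subtractf sum.distrib sum_distrib_left)
    moreover have "\<mu> * ((\<Sum>c\<in>set_pmf F. pmf F c * c * A c) - Bbar) \<le> 0"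
      using A \<mu> by (auto simp: feas intro!: mult_nonneg_nonpos)
    ultimately have le: "(\<Sum>c\<in>set_pmf F. pmf F c * e c) \<le> payoff F A q - payoff F S q" by simp
    have nn: "0 \<le> pmf F c * e c" if "c \<in> set_pmf F" for c using e[OF that] by simp
    then have ge: "0 \<le> (\<Sum>c\<in>set_pmf F. pmf F c * e c)" by (rule sum_nonneg)
    moreover have "A c = S c" if "payoff F A q \<le> payoff F S q" "c \<in> set_pmf F" for c
    proof -
      have "(\<Sum>c\<in>set_pmf F. pmf F c * e c) = 0" using le ge that by simp
      then have "pmf F c * e c = 0"
        using sum_nonneg_eq_0_iff[where f = "\<lambda>c. pmf F c * e c", OF F nn] that(2) by blast
      then show ?thesis using e[OF that(2)] pmf_positive[OF that(2)] by simp
    qed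
    ultimately show ?thesis using le by auto
  qed
  have lower: "ereal (payoff F A q / real n) \<le> worst_variance Z m n F A" if "feasible F Bbar A" for A
  proof -
    have A01: "0 < A c \<and> A c \<le> 1" if "c \<in> set_pmf F" for c
      using \<open>feasible F Bbar A\<close> that by (auto simp: feas)
    have "0 \<le> q c \<and> q c \<le> 1" if "c \<in> set_pmf F" for c using q[OF that] by simp
    from payoff_attained[where A = A and q = q, OF F A01 m m01 m0 m1 n this]
    show ?thesis unfolding worst_variance_def by (auto intro!: SUP_upper2)
  qed
  have feas_S: "feasible F Bbar A" if "\<forall>c\<in>set_pmf F. A c = S c" for A
    using that S anti budget unfolding feas by (auto simp: monotone_on_def)
  have n0: "0 < real n" using n by simp
  show ?thesis
  proof
    assume opt: "optimal Z m n F Bbar A"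
    then have A: "feasible F Bbar A" by (simp add: optimal_def)
    \<comment> \<open>An optimal \<open>A\<close> is worth no more than \<open>S\<close>, whose
      worst case is at most \<open>V\<close>; thus \<open>A\<close> does at least as well as
      \<open>S\<close> against \<open>q\<close>, and the equality case of \<open>gap\<close>
      applies.\<close>
    have "ereal (payoff F A q / real n) \<le> worst_variance Z m n F A" by (rule lower[OF A])
    also have "\<dots> \<le> worst_variance Z m n F S"
      using opt feas_S[of S] by (simp add: optimal_def)
    also have "\<dots> \<le> ereal V" by (rule upper) simp
    finally have "payoff F A q \<le> payoff F S q"
      using n0 by (simp add: V_def divide_le_cancel)
    then show "\<forall>c\<in>set_pmf F. A c = S c" using gap[OF A] by blast
  next
    assume eq: "\<forall>c\<in>set_pmf F. A c = S c"
    have "worst_variance Z m n F A \<le> worst_variance Z m n F A'" if A': "feasible F Bbar A'" for A'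
    proof -
      have "worst_variance Z m n F A \<le> ereal V" by (rule upper[OF eq])
      also have "\<dots> \<le> ereal (payoff F A' q / real n)"
        using gap[OF A'] n0 by (simp add: V_def divide_right_mono)
      also have "\<dots> \<le> worst_variance Z m n F A'" by (rule lower[OF A'])
      finally show ?thesis .
    qed
    then show "optimal Z m n F Bbar A" using feas_S[OF eq] by (simp add: optimal_def)
  qed
qed

lemma antimono_on_capped_sqrt:
  assumes "A \<subseteq> {0<..}" "0 \<le> v" "0 \<le> a"
  shows "antimono_on A (\<lambda>c::real. a * min 1 (sqrt (v / c)))"
  using assms
  by (intro monotone_onI mult_left_mono min.mono order.refl) (auto intro!: divide_left_mono)

section \<open>Indexed costs and the level functions\<close>

locale cost_distribution =
  fixes F :: "real pmf"
  assumes finite_costs: "finite (set_pmf F)" and costs_pos: "set_pmf F \<subseteq> {0<..}"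
begin

abbreviation "N \<equiv> num_costs F"

lemma pos: "c \<in> set_pmf F \<Longrightarrow> 0 < c"
  using costs_pos by auto

lemma cost_in [simp]: "1 \<le> t \<Longrightarrow> t \<le> N \<Longrightarrow> cost F t \<in> set_pmf F"
  using bij_betwE[OF bij_betw_cost[OF finite_costs]] by auto

lemma cost_0 [simp]: "cost F 0 = 0"
  by (simp add: cost_def)

lemma cost_pos [simp]: "1 \<le> t \<Longrightarrow> t \<le> N \<Longrightarrow> 0 < cost F t"
  by (simp add: pos)

lemma N_pos: "1 \<le> N"
  using finite_costs set_pmf_not_empty[of F] by (simp add: num_costs_def Suc_le_eq card_gt_0_iff)

lemma cost_strict_mono: "s < t \<Longrightarrow> t \<le> N \<Longrightarrow> cost F s < cost F t"
proof (cases "s = 0")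
  case False
  assume "s < t" "t \<le> N"
  then show ?thesis
    using False sorted_wrt_nth_less[OF strict_sorted_list_of_set[of "set_pmf F"], of "s - 1" "t - 1"]
    by (simp add: cost_def num_costs_def)
qed simp

lemma cost_mono: "s \<le> t \<Longrightarrow> t \<le> N \<Longrightarrow> cost F s \<le> cost F t"
  using cost_strict_mono[of s t] by (cases "s = t") auto

lemma ball_cost: "(\<forall>t\<in>{1..N}. P (cost F t)) \<longleftrightarrow> (\<forall>c\<in>set_pmf F. P c)"
  unfolding bij_betw_imp_surj_on[OF bij_betw_cost[OF finite_costs], symmetric] by simp

text \<open>Passes from sums over the support to the two-range sums in which \<open>Q\<close> and
  \<open>R\<close> are stated.\<close>

lemma sum_split:
  assumes "k \<le> N"
    and "\<And>t. 1 \<le> t \<Longrightarrow> t \<le> k \<Longrightarrow> g (cost F t) = g1 t"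
    and "\<And>t. k < t \<Longrightarrow> t \<le> N \<Longrightarrow> g (cost F t) = g2 t"
  shows "(\<Sum>c\<in>set_pmf F. g c) = (\<Sum>t=1..k. g1 t) + (\<Sum>t=k+1..N. g2 t)"
proof -
  have "(\<Sum>c\<in>set_pmf F. g c) = (\<Sum>t=1..N. g (cost F t))"
    by (rule sum_cost[OF finite_costs, symmetric])
  also have "\<dots> = (\<Sum>t=1..k. g (cost F t)) + (\<Sum>t=k+1..N. g (cost F t))"
    using sum.ub_add_nat[of 1 k "\<lambda>t. g (cost F t)" "N - k"] assms(1) by simp
  also have "\<dots> = (\<Sum>t=1..k. g1 t) + (\<Sum>t=k+1..N. g2 t)"
    using assms by (intro arg_cong2[where f = "(+)"] sum.cong) auto
  finally show ?thesis .
qed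

lemma expectation_eq_sum: "measure_pmf.expectation F g = (\<Sum>c\<in>set_pmf F. pmf F c * g c)" for g :: "real \<Rightarrow> real"
  by (subst integral_measure_pmf_real[OF finite_costs]) (auto simp: mult.commute)

lemma sum_pmf: "(\<Sum>c\<in>set_pmf F. pmf F c) = 1"
  by (rule sum_pmf_eq_1[OF finite_costs]) simp

text \<open>\<open>Q\<close> and \<open>R\<close> in terms of the single level \<open>v = c\<^sub>k / x\<close>, which runs through \<open>(0, \<infinity>)\<close> as
  \<open>k\<close> and \<open>x\<close> vary.\<close>

definition Q_level :: "real \<Rightarrow> real" where
  "Q_level v = (\<Sum>c\<in>set_pmf F. pmf F c * (c * min 1 (sqrt (v / c))))"

definition R_level :: "real \<Rightarrow> real" where
  "R_level v = 2 * (\<Sum>c\<in>set_pmf F. pmf F c * min 1 (c / v))"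

text \<open>The interval is closed at both ends and unbounded for \<open>k = N\<close>. A level
  equal to a cost thus belongs to two indices; the split formulas below hold for either.\<close>

definition between :: "nat \<Rightarrow> real \<Rightarrow> bool" where
  "between k v \<longleftrightarrow> k \<le> N \<and> cost F k \<le> v \<and> (k < N \<longrightarrow> v \<le> cost F (k + 1))"

lemma between_cost: "k \<le> N \<Longrightarrow> between k (cost F k)"
  by (auto simp: between_def intro: cost_mono)

lemma between_le: "between k v \<Longrightarrow> t \<le> k \<Longrightarrow> cost F t \<le> v"
  using cost_mono[of t k] by (auto simp: between_def)

lemma between_ge: "between k v \<Longrightarrow> k < t \<Longrightarrow> t \<le> N \<Longrightarrow> v \<le> cost F t"
  using cost_mono[of "k + 1" t] by (auto simp: between_def)

text \<open>The cap 1 is attained exactly on the costs up to \<open>v\<close>; beyond them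
  \<open>c * sqrt (v / c)\<close> is \<open>sqrt (c * v)\<close>.\<close>

lemma Q_level_split:
  assumes "between k v" "0 < v"
  shows "Q_level v = (\<Sum>t=1..k. prob_cost F t * cost F t) +
    (\<Sum>t=k+1..N. prob_cost F t * sqrt (cost F t * v))"
  unfolding Q_level_def
proof (rule sum_split)
  show "k \<le> N" using assms by (simp add: between_def)
next
  fix t assume t: "1 \<le> t" "t \<le> k"
  then have "1 \<le> v / cost F t"
    using between_le[OF assms(1) t(2)] assms by (auto simp: between_def)
  then show "pmf F (cost F t) * (cost F t * min 1 (sqrt (v / cost F t))) = prob_cost F t * cost F t"
    by (simp add: prob_cost_def min_def)
next
  fix t assume t: "k < t" "t \<le> N"
  then have c: "v \<le> cost F t" "0 < cost F t" using between_ge[OF assms(1)] by auto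
  then have "min 1 (sqrt (v / cost F t)) = sqrt (v / cost F t)"
    by (intro min.absorb2) simp
  moreover have "cost F t * sqrt (v / cost F t) = sqrt (cost F t * v)"
    using c by (simp add: real_sqrt_divide real_sqrt_mult real_div_sqrt field_simps)
  ultimately show "pmf F (cost F t) * (cost F t * min 1 (sqrt (v / cost F t))) =
      prob_cost F t * sqrt (cost F t * v)"
    by (simp add: prob_cost_def)
qed

lemma R_level_split:
  assumes "between k v" "0 < v"
  shows "R_level v = 2 * ((\<Sum>t=1..k. prob_cost F t * (cost F t / v)) + (\<Sum>t=k+1..N. prob_cost F t))"
  unfolding R_level_def
proof (intro arg_cong[where f = "(*) 2"] sum_split)
  show "k \<le> N" using assms by (simp add: between_def)
next
  fix t assume t: "1 \<le> t" "t \<le> k"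
  show "pmf F (cost F t) * min 1 (cost F t / v) = prob_cost F t * (cost F t / v)"
    using between_le[OF assms(1) t(2)] assms by (simp add: prob_cost_def min_def)
next
  fix t assume t: "k < t" "t \<le> N"
  show "pmf F (cost F t) * min 1 (cost F t / v) = prob_cost F t"
    using between_ge[OF assms(1) t] assms by (simp add: prob_cost_def min_def field_simps)
qed

lemma Q_eq_level:
  assumes "1 \<le> k" "between k (cost F k / x)" "0 < x"
  shows "Q F k x = Q_level (cost F k / x)"
proof -
  have "0 < cost F k / x" using assms by (simp add: between_def)
  then show ?thesis by (simp add: Q_level_split[OF assms(2)] Q_def)
qed

lemma R_eq_level:
  assumes "1 \<le> k" "between k (cost F k / x)" "0 < x"
  shows "R F k x = R_level (cost F k / x)"
proof -
  have "0 < cost F k / x" using assms by (simp add: between_def)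
  then show ?thesis by (simp add: R_level_split[OF assms(2)] R_def)
qed

lemma Q_0: "Q F 0 1 = 0"
  by (simp add: Q_def)

lemma Q_level_mono: "0 < v \<Longrightarrow> v \<le> w \<Longrightarrow> Q_level v \<le> Q_level w"
  unfolding Q_level_def using pos
  by (intro sum_mono mult_left_mono min.mono) (auto intro!: divide_right_mono simp: less_imp_le)

lemma R_level_antimono: "0 < v \<Longrightarrow> v \<le> w \<Longrightarrow> R_level w \<le> R_level v"
  unfolding R_level_def using pos
  by (intro mult_left_mono sum_mono min.mono) (auto intro!: divide_left_mono simp: less_imp_le)

lemma Q_level_pos: "0 < v \<Longrightarrow> 0 < Q_level v"
  unfolding Q_level_def using pos set_pmf_not_empty[of F]
  by (intro sum_pos finite_costs) (auto intro!: mult_pos_pos pmf_positive)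

lemma R_level_pos: "0 < v \<Longrightarrow> 0 < R_level v"
  unfolding R_level_def using pos set_pmf_not_empty[of F]
  by (intro mult_pos_pos sum_pos finite_costs) (auto intro!: mult_pos_pos pmf_positive)

text \<open>A cost above \<open>v\<close> has not reached its cap at \<open>v\<close>, so its term
  still grows.\<close>

lemma Q_level_strict:
  assumes "0 < v" "v < w" "c \<in> set_pmf F" "v < c"
  shows "Q_level v < Q_level w"
  unfolding Q_level_def
proof (rule sum_strict_mono_ex1[OF finite_costs], rule ballI)
  show "pmf F c * (c * min 1 (sqrt (v / c))) \<le> pmf F c * (c * min 1 (sqrt (w / c)))"
    if "c \<in> set_pmf F" for c
    using assms pos that by (intro mult_left_mono min.mono) (auto intro!: divide_right_mono simp: less_imp_le)
  have "sqrt (v / c) < 1" "sqrt (v / c) < sqrt (w / c)"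
    using assms pos[OF assms(3)] by (simp_all add: divide_strict_right_mono)
  then have "min 1 (sqrt (v / c)) < min 1 (sqrt (w / c))" by (simp add: min_def)
  then show "\<exists>c\<in>set_pmf F. pmf F c * (c * min 1 (sqrt (v / c))) < pmf F c * (c * min 1 (sqrt (w / c)))"
    using assms(3) pos[OF assms(3)] pmf_positive[OF assms(3)]
    by (intro bexI[of _ c] mult_strict_left_mono) auto
qed

text \<open>The term of a cost at most \<open>v\<close> is \<open>c / v\<close>, which falls as soon
  as the level rises.\<close>

lemma R_level_strict:
  assumes "0 < v" "v < w" "c \<in> set_pmf F" "c \<le> v"
  shows "R_level w < R_level v"
  unfolding R_level_def
proof (rule mult_strict_left_mono, rule sum_strict_mono_ex1[OF finite_costs], rule ballI)
  show "pmf F c * min 1 (c / w) \<le> pmf F c * min 1 (c / v)"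
    if "c \<in> set_pmf F" for c
    using assms pos that by (intro mult_left_mono min.mono) (auto intro!: divide_left_mono simp: less_imp_le)
  have "c / w < c / v" "c / v \<le> 1"
    using assms pos[OF assms(3)] by (auto intro!: divide_strict_left_mono)
  then have "min 1 (c / w) < min 1 (c / v)" by (simp add: min_def)
  then show "\<exists>c\<in>set_pmf F. pmf F c * min 1 (c / w) < pmf F c * min 1 (c / v)"
    using assms(3) pmf_positive[OF assms(3)]
    by (intro bexI[of _ c] mult_strict_left_mono) auto
qed simp

definition B_level :: "real \<Rightarrow> real" where
  "B_level v = Q_level v / R_level v"

text \<open>One arbitrary cost suffices: if it is at most \<open>v\<close>, the denominator drops
  strictly, and otherwise the numerator grows strictly.\<close>

lemma B_level_strict_mono:
  assumes "0 < v" "v < w"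
  shows "B_level v < B_level w"
proof -
  have w: "0 < w" using assms by simp
  obtain c where c: "c \<in> set_pmf F" using set_pmf_not_empty[of F] by blast
  note ineqs = Q_level_mono[of v w] R_level_antimono[of v w] R_level_pos[OF w] Q_level_pos[OF assms(1)]
  show ?thesis
  proof (cases "c \<le> v")
    case True
    then have "R_level w < R_level v" using R_level_strict assms c by blast
    then show ?thesis unfolding B_level_def using ineqs assms
      by (intro frac_less2) auto
  next
    case False
    then have "Q_level v < Q_level w" using Q_level_strict[OF assms c] by simp
    then show ?thesis unfolding B_level_def using ineqs assms
      by (intro frac_less) auto
  qed
qed

lemma B_level_le_iff: "0 < v \<Longrightarrow> 0 < w \<Longrightarrow> B_level v \<le> B_level w \<longleftrightarrow> v \<le> w"
  using B_level_strict_mono[of v w] B_level_strict_mono[of w v] by (cases v w rule: linorder_cases) auto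

lemma continuous_Q_level: "continuous_on {0<..} Q_level"
  unfolding Q_level_def using pos by (intro continuous_intros) auto

lemma continuous_B_level: "continuous_on {0<..} B_level"
proof -
  have "continuous_on {0<..} R_level"
    unfolding R_level_def using pos by (intro continuous_intros) auto
  then show ?thesis
    unfolding B_level_def using R_level_pos
    by (intro continuous_on_divide continuous_Q_level) (auto simp: less_le)
qed

lemma Q_level_top:
  assumes "\<And>c. c \<in> set_pmf F \<Longrightarrow> c \<le> v"
  shows "Q_level v = measure_pmf.expectation F (\<lambda>c. c)"
  unfolding Q_level_def expectation_eq_sum
proof (rule sum.cong[OF refl])
  fix c assume c: "c \<in> set_pmf F"
  then have "1 \<le> v / c" using assms pos by simp
  then show "pmf F c * (c * min 1 (sqrt (v / c))) = pmf F c * c" by (simp add: min_def)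
qed

lemma R_level_bottom:
  assumes "0 < v" "\<And>c. c \<in> set_pmf F \<Longrightarrow> v \<le> c"
  shows "R_level v = 2"
proof -
  have "R_level v = 2 * (\<Sum>c\<in>set_pmf F. pmf F c)"
    unfolding R_level_def using assms
    by (intro arg_cong[where f = "(*) 2"] sum.cong) (auto simp: min_def field_simps)
  then show ?thesis by (simp add: sum_pmf)
qed

text \<open>Intermediate value theorem between a level below all costs and one above all
  costs.\<close>

lemma B_level_surj:
  assumes b: "0 < b" and b_less: "b < measure_pmf.expectation F (\<lambda>c. c)"
  shows "\<exists>y>0. B_level y = b"
proof -
  let ?E = "measure_pmf.expectation F (\<lambda>c. c)"
  define K where "K = (\<Sum>c\<in>set_pmf F. pmf F c * sqrt c)"
  have K: "0 < K"
    unfolding K_def using pos set_pmf_not_empty[of F]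
    by (intro sum_pos finite_costs) (auto intro!: mult_pos_pos pmf_positive)
  \<comment> \<open>Below all costs \<open>R_level\<close> is 2, and
    \<open>Q_level lo \<le> K * sqrt lo \<le> b\<close>; hence
    \<open>B_level lo \<le> b / 2\<close>.\<close>
  define lo where "lo = min (Min (set_pmf F)) ((b / K)\<^sup>2)"
  \<comment> \<open>Above all costs \<open>Q_level\<close> is the mean cost \<open>?E\<close>, and
    \<open>R_level hi \<le> 2 * ?E / hi \<le> 1\<close>; hence \<open>B_level hi\<close> is at least
    \<open>?E\<close>.\<close>
  define hi where "hi = max (Max (set_pmf F)) (2 * ?E)"
  have lo: "0 < lo" "lo \<le> (b / K)\<^sup>2" "lo \<le> c" if "c \<in> set_pmf F" for c
    using finite_costs that pos[OF Min_in[OF finite_costs set_pmf_not_empty]] b K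
    by (auto simp: lo_def min_le_iff_disj)
  have hi: "c \<le> hi" if "c \<in> set_pmf F" for c
    using finite_costs that by (auto simp: hi_def le_max_iff_disj)
  obtain c where c: "c \<in> set_pmf F" using set_pmf_not_empty[of F] by blast
  have lohi: "lo \<le> hi" using lo(3)[OF c] hi[OF c] by simp
  have hi0: "0 < hi" using lo(1)[OF c] lohi by simp
  have "Q_level lo \<le> (\<Sum>c\<in>set_pmf F. pmf F c * (sqrt c * sqrt lo))"
    unfolding Q_level_def
  proof (intro sum_mono mult_left_mono)
    fix c assume c: "c \<in> set_pmf F"
    have "c * min 1 (sqrt (lo / c)) \<le> c * sqrt (lo / c)"
      using pos[OF c] by (intro mult_left_mono) auto
    also have "\<dots> = sqrt c * sqrt lo"
      using pos[OF c] by (simp add: real_sqrt_divide real_div_sqrt field_simps)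
    finally show "c * min 1 (sqrt (lo / c)) \<le> sqrt c * sqrt lo" .
  qed simp
  also have "\<dots> = K * sqrt lo" by (simp add: K_def sum_distrib_right mult.assoc)
  also have "\<dots> \<le> K * (b / K)"
    using lo[OF c] K b real_sqrt_le_mono[of lo "(b / K)\<^sup>2"] by (intro mult_left_mono) auto
  also have "\<dots> = b" using K by simp
  finally have "B_level lo \<le> b"
    using R_level_bottom[OF lo(1)[OF c] lo(3)] b by (simp add: B_level_def)
  moreover have "b \<le> B_level hi"
  proof -
    have "R_level hi \<le> 2 * (\<Sum>c\<in>set_pmf F. pmf F c * (c / hi))"
      unfolding R_level_def by (intro mult_left_mono sum_mono) auto
    also have "\<dots> = 2 * ?E / hi"
      by (simp add: expectation_eq_sum flip: sum_divide_distrib)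
    also have "\<dots> \<le> 1" using hi0 by (simp add: hi_def)
    finally have "R_level hi \<le> 1" .
    then have "?E / 1 \<le> ?E / R_level hi"
      using R_level_pos[OF hi0] b b_less by (intro divide_left_mono) auto
    then show ?thesis using b_less hi by (simp add: B_level_def Q_level_top)
  qed
  moreover have "continuous_on {lo..hi} B_level"
    by (rule continuous_on_subset[OF continuous_B_level]) (use lo(1)[OF c] in auto)
  ultimately obtain y where "lo \<le> y" "B_level y = b"
    using IVT'[of B_level lo b hi] lohi by blast
  then show ?thesis using lo(1)[OF c] by (intro exI[of _ y]) auto
qed

lemma Q_level_surj_above:
  assumes y: "0 < y" "Q_level y \<le> b" and b: "b < measure_pmf.expectation F (\<lambda>c. c)"
  shows "\<exists>w\<ge>y. Q_level w = b"
proof -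
  define hi where "hi = max y (Max (set_pmf F))"
  have "c \<le> hi" if "c \<in> set_pmf F" for c
    using finite_costs that by (auto simp: hi_def le_max_iff_disj)
  then have "b \<le> Q_level hi" using b by (simp add: Q_level_top)
  moreover have "continuous_on {y..hi} Q_level"
    by (rule continuous_on_subset[OF continuous_Q_level]) (use y in auto)
  ultimately show ?thesis
    using IVT'[of Q_level y b hi] y by (auto simp: hi_def)
qed

text \<open>\<open>Q_level\<close> is constantly the mean cost from the largest cost on. The last
  assumption keeps \<open>w\<close> off this flat part.\<close>

lemma Q_level_less_iff:
  assumes "0 < v" "0 < w" "Q_level w < measure_pmf.expectation F (\<lambda>c. c)"
  shows "Q_level v < Q_level w \<longleftrightarrow> v < w"
proof
  assume "Q_level v < Q_level w"
  then show "v < w" using Q_level_mono[of w v] assms by force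
next
  assume vw: "v < w"
  show "Q_level v < Q_level w"
  proof (cases "\<exists>c\<in>set_pmf F. v < c")
    case True
    then show ?thesis using Q_level_strict[OF assms(1) vw] by blast
  next
    case False
    then have "Q_level v = measure_pmf.expectation F (\<lambda>c. c)"
      by (intro Q_level_top) (auto simp: not_less)
    then show ?thesis using Q_level_mono[of v w] assms vw by simp
  qed
qed

section \<open>The parameters expressed by the level\<close>

text \<open>At \<open>x = 1\<close> the level is \<open>cost F k\<close>, so comparing budgets is
  comparing levels by monotonicity of \<open>B_level\<close>. Index 0 is separate since levels are
  positive: there both sides hold.\<close>

lemma budget_fn_le_iff:
  assumes "k \<le> N" "0 < y" "B_level y = b"
  shows "budget_fn F k 1 \<le> ereal b \<longleftrightarrow> cost F k \<le> y"
proof (cases "k = 0")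
  case True
  have "0 < B_level y"
    using Q_level_pos[OF assms(2)] R_level_pos[OF assms(2)] by (simp add: B_level_def)
  then show ?thesis using True assms by (simp add: budget_fn_def Q_0)
next
  case False
  then have "Q F k 1 / R F k 1 = B_level (cost F k)"
    using Q_eq_level[of k 1] R_eq_level[of k 1] between_cost assms by (simp add: B_level_def)
  then show ?thesis
    using False assms B_level_le_iff[of "cost F k" y] by (simp add: budget_fn_def)
qed

text \<open>The infinite value at index \<open>N + 1\<close> turns the upper bound into no condition
  for \<open>k = N\<close>.\<close>

lemma is_kstar_iff:
  assumes "0 < y" "B_level y = b"
  shows "is_kstar F b k \<longleftrightarrow> k \<le> N \<and> cost F k \<le> y \<and> (k < N \<longrightarrow> y < cost F (k + 1))"
proof -
  have "ereal b < budget_fn F (k + 1) 1 \<longleftrightarrow> (k < N \<longrightarrow> y < cost F (k + 1))" if "k \<le> N"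
  proof (cases "k = N")
    case True
    then show ?thesis by (simp add: budget_fn_def)
  next
    case False
    then show ?thesis using budget_fn_le_iff[of "k + 1", OF _ assms] that by (simp flip: not_le)
  qed
  then show ?thesis
    using budget_fn_le_iff[OF _ assms, of k] by (auto simp: is_kstar_def)
qed

text \<open>The half-open intervals from \<open>cost F k\<close> to \<open>cost F (k + 1)\<close>,
  the last one unbounded, partition the positive levels, so \<open>y\<close> lies in exactly
  one.\<close>

lemma ex1_is_kstar:
  assumes "0 < y" "B_level y = b"
  shows "\<exists>!k. is_kstar F b k"
proof (rule ex_ex1I)
  define k where "k = Max {k \<in> {0..N}. cost F k \<le> y}"
  have fin: "finite {k \<in> {0..N}. cost F k \<le> y}" by simp
  have "k \<in> {k \<in> {0..N}. cost F k \<le> y}"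
    unfolding k_def using assms by (intro Max_in fin) (auto intro!: exI[of _ 0])
  moreover have "y < cost F (k + 1)" if "k < N"
  proof (rule ccontr)
    assume "\<not> y < cost F (k + 1)"
    then have "k + 1 \<le> k"
      unfolding k_def using that by (intro Max_ge fin) (auto simp: k_def)
    then show False by simp
  qed
  ultimately show "\<exists>k. is_kstar F b k" by (auto simp: is_kstar_iff[OF assms])
next
  fix k k' assume "is_kstar F b k" "is_kstar F b k'"
  then have *: "k \<le> N" "cost F k \<le> y" "k < N \<Longrightarrow> y < cost F (k + 1)"
    "k' \<le> N" "cost F k' \<le> y" "k' < N \<Longrightarrow> y < cost F (k' + 1)"
    by (auto simp: is_kstar_iff[OF assms])
  show "k = k'"
  proof (cases k k' rule: linorder_cases)
    case less
    then show ?thesis using * cost_mono[of "k + 1" k'] by force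
  next
    case greater
    then show ?thesis using * cost_mono[of "k' + 1" k] by force
  qed
qed

lemma is_xstar_iff:
  assumes y: "0 < y" "B_level y = b" and k: "is_kstar F b k" "k \<noteq> 0"
  shows "is_xstar F b k x \<longleftrightarrow> x = cost F k / y"
proof -
  have kN: "1 \<le> k" "k \<le> N" "cost F k \<le> y" and btw: "between k y"
    using k by (auto simp: is_kstar_iff[OF y] between_def less_imp_le)
  have c: "0 < cost F k" using kN by simp
  \<comment> \<open>Uniqueness needs the formulas at fixed \<open>k\<close>: for small
    \<open>x\<close> the level \<open>cost F k / x\<close> may pass \<open>cost F (k + 1)\<close>,
    where they no longer agree with the level functions.\<close>
  have anti: "Q F k x2 / R F k x2 < Q F k x1 / R F k x1" if x: "0 < x1" "x1 < x2" for x1 x2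
  proof (rule frac_less2)
    show "Q F k x2 \<le> Q F k x1"
      unfolding Q_def using x c kN
      by (intro add_left_mono sum_mono mult_left_mono)
        (auto simp: prob_cost_def intro!: divide_left_mono less_imp_le[OF mult_pos_pos])
    have p: "0 < prob_cost F t" if "1 \<le> t" "t \<le> N" for t
      using that by (simp add: prob_cost_def pmf_positive)
    have s: "0 < (\<Sum>t=1..k. prob_cost F t * (cost F t * x1 / cost F k))"
      using x c kN p by (intro sum_pos) auto
    have r: "0 \<le> (\<Sum>t=k+1..N. prob_cost F t)"
      by (intro sum_nonneg) (simp add: prob_cost_def)
    show "0 < R F k x1" using s r by (simp add: R_def)
    have "(\<Sum>t=1..k. prob_cost F t * (cost F t * x1 / cost F k)) <
        (\<Sum>t=1..k. prob_cost F t * (cost F t * x2 / cost F k))"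
      using x c kN p by (intro sum_strict_mono) (auto intro!: mult_strict_left_mono divide_strict_right_mono)
    then show "R F k x1 < R F k x2" by (simp add: R_def)
    have "0 < (\<Sum>t=1..k. prob_cost F t * cost F t)"
      using kN p by (intro sum_pos) auto
    moreover have "0 \<le> (\<Sum>t=k+1..N. prob_cost F t * sqrt (cost F t * cost F k / x2))"
      using x c kN by (intro sum_nonneg) (auto simp: prob_cost_def less_imp_le)
    ultimately show "0 < Q F k x2" by (simp add: Q_def)
  qed
  have "cost F k / (cost F k / y) = y" using c by simp
  then have val: "Q F k (cost F k / y) / R F k (cost F k / y) = b"
    using Q_eq_level[of k "cost F k / y"] R_eq_level[of k "cost F k / y"] kN y btw c
    by (simp add: B_level_def)
  have "0 < cost F k / y" "cost F k / y \<le> 1"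
    using divide_pos_pos[OF c y(1)] divide_le_eq_1_pos[OF y(1)] kN by blast+
  then have sol: "is_xstar F b k (cost F k / y)"
    using val kN by (simp add: is_xstar_def budget_fn_def)
  moreover have "x = cost F k / y" if "is_xstar F b k x"
  proof -
    have "0 < x" "Q F k x / R F k x = b"
      using that kN by (auto simp: is_xstar_def budget_fn_def)
    then show ?thesis
      using anti[of x "cost F k / y"] anti[of "cost F k / y" x] val c y
      by (cases x "cost F k / y" rule: linorder_cases) auto
  qed
  ultimately show ?thesis by blast
qed

text \<open>Splitting \<open>Q_level v\<close> at \<open>s\<close> shows that the budget left after
  the first \<open>s\<close> costs is \<open>a * sqrt v * L\<close>, with \<open>L\<close> the
  denominator of the rule. The quotient is therefore \<open>a * sqrt v\<close>.\<close>

lemma threshold_rule_eq_level: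
  assumes s: "between s v" and v: "0 < v" and b: "b = a * Q_level v" and t: "1 \<le> t" "t \<le> N"
  shows "threshold_rule F b s a t = a * min 1 (sqrt (v / cost F t))"
proof (cases "t \<le> s")
  case True
  then have "1 \<le> v / cost F t" using between_le[OF s True] t by simp
  then show ?thesis using True by (simp add: threshold_rule_def min_def)
next
  case False
  have sN: "s \<le> N" using s by (simp add: between_def)
  have c: "v \<le> cost F t" "0 < cost F t" using between_ge[OF s] False t by auto
  have 1: "measure_pmf.expectation F (\<lambda>c. c * indicator {..cost F s} c) = (\<Sum>t=1..s. prob_cost F t * cost F t)"
    unfolding expectation_eq_sum using sN
    by (subst sum_split[where k = s and ?g1.0 = "\<lambda>t. prob_cost F t * cost F t" and ?g2.0 = "\<lambda>_. 0"])
      (auto simp: prob_cost_def indicator_def cost_mono dest: cost_strict_mono)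
  define L where "L = (\<Sum>t=s+1..N. prob_cost F t * sqrt (cost F t))"
  have 2: "measure_pmf.expectation F (\<lambda>c. sqrt c * indicator {cost F s<..} c) = L"
    unfolding expectation_eq_sum L_def using sN
    by (subst sum_split[where k = s and ?g2.0 = "\<lambda>t. prob_cost F t * sqrt (cost F t)" and ?g1.0 = "\<lambda>_. 0"])
      (auto simp: prob_cost_def indicator_def cost_strict_mono dest: cost_mono)
  have L: "0 < L"
    unfolding L_def using False t
    by (intro sum_pos) (auto simp: prob_cost_def pmf_positive)
  have "Q_level v = (\<Sum>t=1..s. prob_cost F t * cost F t) + sqrt v * L"
    unfolding Q_level_split[OF s v] L_def sum_distrib_left by (simp add: real_sqrt_mult mult_ac)
  then have "threshold_rule F b s a t = 1 / sqrt (cost F t) * ((a * sqrt v * L) / L)"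
    using False by (simp add: threshold_rule_def 1 2 b algebra_simps)
  also have "\<dots> = a * sqrt (v / cost F t)" using L by (simp add: real_sqrt_divide)
  finally show ?thesis using c v by (simp add: min_def)
qed

text \<open>Makes the unconstrained \<open>a\<close> harmless at threshold 0: no cost is at most
  \<open>cost F 0 = 0\<close>, so the expectation multiplied by \<open>a\<close> vanishes.\<close>

lemma threshold_rule_0: "1 \<le> t \<Longrightarrow> threshold_rule F b 0 a t = threshold_rule F b 0 a' t"
proof -
  have "measure_pmf.expectation F (\<lambda>c. c * indicator {..cost F 0} c) = 0"
    unfolding expectation_eq_sum by (intro sum.neutral) (auto simp: indicator_def dest!: pos)
  then show "1 \<le> t \<Longrightarrow> ?thesis" by (simp add: threshold_rule_def)
qed

section \<open>Saddle points at the level given by the budget\<close>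

text \<open>The value of \<open>\<mu>\<close> solves \<open>q c = \<mu> * c * (S c)^2\<close>, and
  \<open>\<theta>\<close> is the mean of \<open>q\<close> by definition of \<open>R_level\<close>.
  The bound \<open>1 \<le> R_level y\<close> keeps the rule at most 1.\<close>

lemma optimal_iff_interior:
  fixes Z :: "'z measure"
  assumes m: "m \<in> borel_measurable Z" and m01: "\<And>z. z \<in> space Z \<Longrightarrow> 0 \<le> m z \<and> m z \<le> 1"
    and m0: "\<exists>z\<in>space Z. m z = 0" and m1: "\<exists>z\<in>space Z. m z = 1" and n: "n \<ge> 1"
    and y: "0 < y" "B_level y = b" and R1: "1 \<le> R_level y"
  shows "optimal Z m n F b A \<longleftrightarrow>
    (\<forall>c\<in>set_pmf F. A c = (1 / R_level y) * min 1 (sqrt (y / c)))"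
proof (rule optimal_iff_saddle_point[where q = "\<lambda>c. min 1 (c / y)" and \<mu> = "(R_level y)\<^sup>2 / y"
      and \<theta> = "R_level y / 2", OF m m01 m0 m1 n finite_costs costs_pos])
  let ?r = "R_level y"
  have r: "0 < ?r" using R1 by simp
  show "antimono_on (set_pmf F) (\<lambda>c. (1 / ?r) * min 1 (sqrt (y / c)))"
    using costs_pos y r by (intro antimono_on_capped_sqrt) auto
  show "(\<Sum>c\<in>set_pmf F. pmf F c * c * ((1 / ?r) * min 1 (sqrt (y / c)))) = b"
    unfolding y(2)[symmetric] B_level_def Q_level_def sum_divide_distrib
    by (intro sum.cong) auto
  show "0 < ?r\<^sup>2 / y" using r y by simp
  show "?r / 2 = (\<Sum>c\<in>set_pmf F. pmf F c * min 1 (c / y))"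
    by (simp add: R_level_def)
next
  let ?r = "R_level y"
  have r: "0 < ?r" using R1 by simp
  fix c assume "c \<in> set_pmf F"
  then have c: "0 < c" by (rule pos)
  let ?s = "min 1 (sqrt (y / c))"
  have s: "0 < ?s" "?s \<le> 1" using c y by auto
  show "0 < (1 / ?r) * ?s \<and> (1 / ?r) * ?s \<le> 1"
    using s r R1 mult_mono[of "1 / ?r" 1 ?s 1] by simp
  show "0 < min 1 (c / y) \<and> min 1 (c / y) \<le> 1" using c y by simp
  \<comment> \<open>This identity gives equality in the first-order condition for the rule at every
    cost, on either side of \<open>y\<close>.\<close>
  have ratio: "c * ?s\<^sup>2 / y = min 1 (c / y)"
  proof (cases "c \<le> y")
    case True
    then have "1 \<le> y / c" using c by simp
    then show ?thesis using True y by (simp add: min_def)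
  next
    case False
    then have "y / c < 1" using c by simp
    then have "?s = sqrt (y / c)" by (intro min.absorb2) simp
    then show ?thesis using False y c by (simp add: min_def)
  qed
  have "?r\<^sup>2 / y * c * ((1 / ?r) * ?s)\<^sup>2 = c * ?s\<^sup>2 / y"
    using r by (simp add: power_divide)
  then have eq: "?r\<^sup>2 / y * c * ((1 / ?r) * ?s)\<^sup>2 = min 1 (c / y)" by (simp only: ratio)
  then show "?r\<^sup>2 / y * c * ((1 / ?r) * ?s)\<^sup>2 \<le> min 1 (c / y)" by simp
  show "(1 / ?r) * ?s = 1 \<or> min 1 (c / y) = ?r\<^sup>2 / y * c * ((1 / ?r) * ?s)\<^sup>2"
    using eq by simp
  have inv: "1 / ((1 / ?r) * ?s) = ?r / ?s" using r by simp
  show "2 * (?r / 2) \<le> 1 / ((1 / ?r) * ?s)"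
    unfolding inv using s r by (simp add: pos_le_divide_eq mult_left_le)
  show "min 1 (c / y) = 1 \<or> 1 / ((1 / ?r) * ?s) = 2 * (?r / 2)"
    unfolding inv
  proof (cases "c \<le> y")
    case True
    then have "?s = 1" using c by simp
    then show "min 1 (c / y) = 1 \<or> ?r / ?s = 2 * (?r / 2)" by simp
  next
    case False
    then show "min 1 (c / y) = 1 \<or> ?r / ?s = 2 * (?r / 2)" using y by simp
  qed
qed

text \<open>Here the best response \<open>q\<close> is not unique on the costs with \<open>A c = 1\<close>; it is chosen with mean
  \<open>1/2\<close>, which makes the adversary indifferent there.\<close>

lemma optimal_iff_capped:
  fixes Z :: "'z measure"
  assumes m: "m \<in> borel_measurable Z" and m01: "\<And>z. z \<in> space Z \<Longrightarrow> 0 \<le> m z \<and> m z \<le> 1"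
    and m0: "\<exists>z\<in>space Z. m z = 0" and m1: "\<exists>z\<in>space Z. m z = 1" and n: "n \<ge> 1"
    and w: "0 < w" "Q_level w = b" and R1: "R_level w \<le> 1"
  shows "optimal Z m n F b A \<longleftrightarrow> (\<forall>c\<in>set_pmf F. A c = min 1 (sqrt (w / c)))"
proof -
  define \<theta>0 where "\<theta>0 = R_level w / 2"
  have \<theta>0: "\<theta>0 \<le> 1 / 2" "\<theta>0 = (\<Sum>c\<in>set_pmf F. pmf F c * min 1 (c / w))"
    using R1 by (simp_all add: \<theta>0_def R_level_def)
  \<comment> \<open>The weight for mixing \<open>min 1 (c / w)\<close>, of mean
    \<open>\<theta>0 \<le> 1 / 2\<close>, with the constant 1 so that the mixture has mean
    1/2.\<close>
  define s where "s = (1 / 2 - \<theta>0) / (1 - \<theta>0)"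
  have s: "0 \<le> s" "s \<le> 1" "(1 - s) * \<theta>0 + s = 1 / 2"
  proof -
    show "0 \<le> s" "s \<le> 1" using \<theta>0(1) by (simp_all add: s_def)
    have "s * (1 - \<theta>0) = 1 / 2 - \<theta>0" using \<theta>0(1) by (simp add: s_def)
    then show "(1 - s) * \<theta>0 + s = 1 / 2" by (simp add: algebra_simps)
  qed
  define q where "q c = (1 - s) * min 1 (c / w) + s" for c
  have q_mix: "min 1 (c / w) \<le> q c \<and> q c \<le> 1" for c
  proof -
    have "q c - min 1 (c / w) = s * (1 - min 1 (c / w))" by (simp add: q_def algebra_simps)
    moreover have "0 \<le> s * (1 - min 1 (c / w))" using s by simp
    moreover have "(1 - s) * min 1 (c / w) \<le> (1 - s) * 1" using s by (intro mult_left_mono) auto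
    ultimately show ?thesis by (simp add: q_def)
  qed
  \<comment> \<open>Costs from \<open>w\<close> on satisfy slackness through \<open>q c = 1\<close>,
    costs up to \<open>w\<close> through a rule equal to 1, whose inverse is
    \<open>2 * (1 / 2)\<close>.\<close>
  have big: "q c = 1 \<and> w * 1 = c * (min 1 (sqrt (w / c)))\<^sup>2" if "w \<le> c" for c
  proof -
    have "w / c \<le> 1" using that w by simp
    then have "min 1 (sqrt (w / c)) = sqrt (w / c)" by (intro min.absorb2) simp
    moreover have "min 1 (c / w) = 1" using that w by simp
    ultimately show ?thesis using that w by (simp add: q_def)
  qed
  have small: "min 1 (sqrt (w / c)) = 1" if "c \<in> set_pmf F" "c \<le> w" for c
    using that pos by simp
  \<comment> \<open>The factor 1 matches the shape required by
    \<open>antimono_on_capped_sqrt\<close>.\<close>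
  have "optimal Z m n F b A \<longleftrightarrow> (\<forall>c\<in>set_pmf F. A c = 1 * min 1 (sqrt (w / c)))"
  proof (rule optimal_iff_saddle_point[where q = q and \<mu> = "1 / w" and \<theta> = "1 / 2",
        OF m m01 m0 m1 n finite_costs costs_pos])
    show "antimono_on (set_pmf F) (\<lambda>c. 1 * min 1 (sqrt (w / c)))"
      using costs_pos w by (intro antimono_on_capped_sqrt) auto
    show "(\<Sum>c\<in>set_pmf F. pmf F c * c * (1 * min 1 (sqrt (w / c)))) = b"
      unfolding w(2)[symmetric] Q_level_def by (intro sum.cong) auto
    show "0 < 1 / w" using w by simp
    have "(\<Sum>c\<in>set_pmf F. pmf F c * q c) = (1 - s) * \<theta>0 + s * (\<Sum>c\<in>set_pmf F. pmf F c)"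
      unfolding q_def \<theta>0(2) by (simp add: sum_distrib_left sum.distrib distrib_left mult_ac)
    then show "1 / 2 = (\<Sum>c\<in>set_pmf F. pmf F c * q c)"
      using s by (simp add: sum_pmf)
  next
    fix c assume cF: "c \<in> set_pmf F"
    then have c: "0 < c" by (rule pos)
    show "0 < 1 * min 1 (sqrt (w / c)) \<and> 1 * min 1 (sqrt (w / c)) \<le> 1"
      using c w by simp
    have "0 < min 1 (c / w)" using c w by simp
    then show "0 < q c \<and> q c \<le> 1" using q_mix[of c] by linarith
    show "1 / w * c * (1 * min 1 (sqrt (w / c)))\<^sup>2 \<le> q c"
    proof (cases "c \<le> w")
      case True
      then show ?thesis using small[OF cF True] q_mix[of c] w by simp
    next
      case False
      then show ?thesis using big[of c] w by simp
    qed
    show "1 * min 1 (sqrt (w / c)) = 1 \<or> q c = 1 / w * c * (1 * min 1 (sqrt (w / c)))\<^sup>2"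
      using small[OF cF] big[of c] w by (cases "c \<le> w") auto
    show "2 * (1 / 2) \<le> 1 / (1 * min 1 (sqrt (w / c)))"
      using c w by simp
    show "q c = 1 \<or> 1 / (1 * min 1 (sqrt (w / c))) = 2 * (1 / 2)"
      using small[OF cF] big[of c] by (cases "c \<le> w") auto
  qed
  then show ?thesis by simp
qed

lemma Q_less_iff:
  assumes "j \<le> N" "0 < w" "Q_level w = b" "b < measure_pmf.expectation F (\<lambda>c. c)"
  shows "Q F j 1 < b \<longleftrightarrow> cost F j < w"
proof (cases "j = 0")
  case True
  then show ?thesis using assms Q_level_pos[OF assms(2)] by (simp add: Q_0)
next
  case False
  then show ?thesis
    using Q_eq_level[of j 1] between_cost[of j] Q_level_less_iff[of "cost F j" w] assms by simp
qed

text \<open>\<open>Q F j 1\<close> is \<open>Q_level\<close> at \<open>cost F j\<close> for positive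
  \<open>j\<close>, so the set consists of the indices with cost below \<open>w\<close>. If
  \<open>w\<close> is itself a cost, the strict inequality selects the index before it, which
  \<open>between\<close> admits.\<close>

lemma between_Max_Q_less:
  assumes "0 < w" "Q_level w = b" "b < measure_pmf.expectation F (\<lambda>c. c)"
  shows "between (Max {j \<in> {0..N}. b > Q F j 1}) w"
proof -
  define J where "J = {j \<in> {0..N}. b > Q F j 1}"
  have J: "J = {j \<in> {0..N}. cost F j < w}"
    using Q_less_iff[OF _ assms] by (auto simp: J_def)
  have fin: "finite J" by (simp add: J)
  have "Max J \<in> J"
    using assms by (intro Max_in fin) (auto simp: J intro!: exI[of _ 0])
  moreover have "w \<le> cost F (Max J + 1)" if "Max J < N"
  proof (rule ccontr)
    assume "\<not> w \<le> cost F (Max J + 1)"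
    then have "Max J + 1 \<in> J" using that by (simp add: J)
    then have "Max J + 1 \<le> Max J" by (rule Max_ge[OF fin])
    then show False by simp
  qed
  ultimately have "between (Max J) w" by (auto simp: between_def J)
  then show ?thesis by (simp add: J_def)
qed

text \<open>Eliminates \<open>k\<close> and \<open>x\<close> in favour of \<open>y\<close>: the
  solution is \<open>x = cost F k / y\<close>, so \<open>R F k x\<close> is
  \<open>R_level y\<close>. In the case \<open>zero\<close> nothing is known about
  \<open>a\<close>.\<close>

lemma is_params_cases:
  assumes y: "0 < y" "B_level y = b" and p: "is_params F b t a"
  obtains (zero) "t = 0" "y < cost F 1"
  | (interior) "between t y" "1 \<le> R_level y" "a = 1 / R_level y"
  | (capped) "t = Max {j \<in> {0..N}. b > Q F j 1}" "R_level y < 1" "a = 1"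
proof -
  obtain k where k: "is_kstar F b k" and kt: "if k = 0 then t = 0
         else (\<exists>x. is_xstar F b k x \<and> (if R F k x \<ge> 1 then t = k \<and> a = 1 / R F k x
                 else t = Max {j \<in> {0..N}. b > Q F j 1} \<and> a = 1))"
    using p by (auto simp: is_params_def)
  show thesis
  proof (cases "k = 0")
    case True
    then show ?thesis using zero k kt N_pos by (simp add: is_kstar_iff[OF y])
  next
    case False
    have btw: "between k y"
      using k by (auto simp: is_kstar_iff[OF y] between_def less_imp_le)
    then have k1: "1 \<le> k" "0 < cost F k" using False by (auto simp: between_def)
    define x where "x = cost F k / y"
    have x: "cost F k / x = y" "0 < x" using k1 y by (simp_all add: x_def)
    have "R F k x = R_level y" using R_eq_level[of k x] btw k1 x by simp
    moreover have "if R F k x \<ge> 1 then t = k \<and> a = 1 / R F k x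
        else t = Max {j \<in> {0..N}. b > Q F j 1} \<and> a = 1"
      using kt False by (simp add: is_xstar_iff[OF y k False] x_def)
    ultimately show ?thesis
      using interior capped btw by (auto split: if_splits)
  qed
qed

lemma optimal_iff_threshold_rule:
  fixes Z :: "'z measure"
  assumes m: "m \<in> borel_measurable Z" and m01: "\<And>z. z \<in> space Z \<Longrightarrow> 0 \<le> m z \<and> m z \<le> 1"
    and m0: "\<exists>z\<in>space Z. m z = 0" and m1: "\<exists>z\<in>space Z. m z = 1" and n: "n \<ge> 1"
    and y: "0 < y" "B_level y = b" and b: "0 < b" "b < measure_pmf.expectation F (\<lambda>c. c)"
    and p: "is_params F b s a"
  shows "s \<le> N \<and>
    (\<forall>A. optimal Z m n F b A \<longleftrightarrow> (\<forall>t\<in>{1..N}. A (cost F t) = threshold_rule F b s a t))"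
proof -
  have bQ: "b = 1 / R_level y * Q_level y" using y by (simp add: B_level_def)
  note interior_opt = optimal_iff_interior[OF m m01 m0 m1 n y]
  \<comment> \<open>The cases differ only in the closed form \<open>S\<close> of the rule.\<close>
  have finish: ?thesis
    if "s \<le> N" "\<And>t. 1 \<le> t \<Longrightarrow> t \<le> N \<Longrightarrow> threshold_rule F b s a t = S (cost F t)"
      "\<And>A. optimal Z m n F b A \<longleftrightarrow> (\<forall>c\<in>set_pmf F. A c = S c)" for S
  proof -
    have "(\<forall>t\<in>{1..N}. A (cost F t) = threshold_rule F b s a t) \<longleftrightarrow> (\<forall>t\<in>{1..N}. A (cost F t) = S (cost F t))" for A
      using that(2) by (intro ball_cong) auto
    then show ?thesis
      using that(1,3) ball_cost[of "\<lambda>c. A c = S c" for A] by blast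
  qed
  show ?thesis
    using y p
  proof (cases rule: is_params_cases)
    case zero
    \<comment> \<open>All costs lie above \<open>y\<close>, so this is an interior saddle point with
      threshold 0.\<close>
    have "R_level y = 2"
    proof (rule R_level_bottom[OF y(1)])
      fix c assume "c \<in> set_pmf F"
      then obtain t where t: "t \<in> {1..N}" "c = cost F t"
        using bij_betw_imp_surj_on[OF bij_betw_cost[OF finite_costs]] by blast
      then show "y \<le> c" using zero cost_mono[of 1 t] by simp
    qed
    moreover have "between 0 y" using zero y by (simp add: between_def)
    ultimately show ?thesis
      using threshold_rule_eq_level[OF _ y(1) bQ, of 0] threshold_rule_0[of _ b a "1 / R_level y"] zero
      by (intro finish[OF _ _ interior_opt]) simp_all
  next
    case interior
    then show ?thesis
      using threshold_rule_eq_level[OF interior(1) y(1) bQ]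
      by (intro finish[OF _ _ interior_opt]) (simp_all add: between_def)
  next
    case capped
    \<comment> \<open>With factor 1 the level \<open>y\<close> spends only
      \<open>Q_level y \<le> b\<close>. Raising the level to \<open>w\<close> exhausts the budget,
      and \<open>R_level\<close> stays at most 1.\<close>
    have "Q_level y = b * R_level y" using bQ R_level_pos[OF y(1)] by simp
    also have "\<dots> \<le> b" using capped b by (simp add: mult_left_le)
    finally obtain w where w: "y \<le> w" "Q_level w = b"
      using Q_level_surj_above[OF y(1) _ b(2)] by blast
    have w0: "0 < w" using w y by simp
    have btw: "between s w"
      unfolding capped by (rule between_Max_Q_less[OF w0 w(2) b(2)])
    have "R_level w \<le> 1"
      using R_level_antimono[OF y(1) w(1)] capped by simp
    then show ?thesis
      using threshold_rule_eq_level[OF btw w0, of b a] btw capped w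
      by (intro finish[OF _ _ optimal_iff_capped[OF m m01 m0 m1 n w0 w(2)]]) (simp_all add: between_def)
  qed
qed

end

theorem theorem4:
  fixes Z :: "'z measure" and m :: "'z \<Rightarrow> real" and F :: "real pmf"
    and n :: nat and B Bbar :: real
  assumes m_measurable: "m \<in> borel_measurable Z"
    and m_range: "\<And>z. z \<in> space Z \<Longrightarrow> 0 \<le> m z \<and> m z \<le> 1"
    and m_zero: "\<exists>z\<in>space Z. m z = 0"
    and m_one: "\<exists>z\<in>space Z. m z = 1"
    and n_pos: "n \<ge> 1"
    and F_finite: "finite (set_pmf F)"
    and F_pos: "set_pmf F \<subseteq> {0<..}"
    and Bbar: "Bbar = B / real n"
    and Bbar_pos: "0 < Bbar"
    and Bbar_less: "Bbar < measure_pmf.expectation F (\<lambda>c. c)"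
  shows "(\<exists>!k. is_kstar F Bbar k) \<and>
    (\<forall>k. is_kstar F Bbar k \<and> k \<noteq> 0 \<longrightarrow> (\<exists>!x. is_xstar F Bbar k x)) \<and>
    (\<exists>tstar a. is_params F Bbar tstar a) \<and>
    (\<forall>tstar a. is_params F Bbar tstar a \<longrightarrow>
       tstar \<le> num_costs F \<and>
       (\<forall>A. optimal Z m n F Bbar A \<longleftrightarrow>
            (\<forall>t\<in>{1..num_costs F}. A (cost F t) = threshold_rule F Bbar tstar a t)))"
proof -
  interpret cost_distribution F
    using F_finite F_pos by unfold_locales
  \<comment> \<open>The level at which the budget is met; existence and uniqueness of the parameters
    and the form of the rule are all read off from it.\<close>
  obtain y where y: "0 < y" "B_level y = Bbar"
    using B_level_surj[OF Bbar_pos Bbar_less] by blast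
  have kstar: "\<exists>!k. is_kstar F Bbar k" by (rule ex1_is_kstar[OF y])
  have xstar: "\<exists>!x. is_xstar F Bbar k x" if "is_kstar F Bbar k" "k \<noteq> 0" for k
    using is_xstar_iff[OF y that] by simp
  have params: "\<exists>tstar a. is_params F Bbar tstar a"
  proof -
    obtain k where k: "is_kstar F Bbar k" using kstar by blast
    show ?thesis
    proof (cases "k = 0")
      case True
      then show ?thesis using k by (auto simp: is_params_def)
    next
      case False
      then obtain x where x: "is_xstar F Bbar k x" using xstar[OF k] by blast
      have "is_params F Bbar (if R F k x \<ge> 1 then k else Max {j \<in> {0..N}. Bbar > Q F j 1})
          (if R F k x \<ge> 1 then 1 / R F k x else 1)"
        unfolding is_params_def using x False
        by (intro exI[of _ k] conjI k) (auto intro!: exI[of _ x])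
      then show ?thesis by blast
    qed
  qed
  have rule: "tstar \<le> N \<and>
      (\<forall>A. optimal Z m n F Bbar A \<longleftrightarrow>
           (\<forall>t\<in>{1..N}. A (cost F t) = threshold_rule F Bbar tstar a t))"
    if "is_params F Bbar tstar a" for tstar a
    by (rule optimal_iff_threshold_rule[OF m_measurable m_range m_zero m_one n_pos y
          Bbar_pos Bbar_less that])
  show ?thesis
    by (intro conjI kstar params)
      (intro allI impI, elim conjE, rule xstar, assumption+, intro allI impI, rule rule)
qed

end
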